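(* Let $\varepsilon_1,\ldots,\varepsilon_k$ be $k$ nonnegative real numbers with $\varepsilon_1+\cdots +\varepsilon_k=1$. If $G$ is a graph and $V_1,V_2$ is a bipartition of $V(G)$, then $G$ can be edge-decomposed into $k$ factors $G_1,\ldots, G_k$ satisfying the following properties: (1) for each $q\in\{1,2\}$, all $v\in V_q$ and all $1\le i\le k$, $|d_{G_i}(v)-\varepsilon_i d_G(v)|<3q$; (2) for any $v\in V_2$, there exists at most one index $j_v\in \{1,\ldots, k\}$ with $d_{G_{j_v}}(v)$ odd. Furthermore, if $\varepsilon_1>0$ and $G$ is odd-$\lceil 1/\varepsilon_1\rceil $-edge-connected, then the factors can be chosen such that (1) and (2) hold and $j_v=1$ for all odd-degree vertices $v\in V_2$.
   Context: Graphs may have loops and multiple edges; $d_G(v)$ is the degree of $v$ in $G$ (a loop counts twice). A factor of $G$ is a spanning subgraph of $G$; $G$ is edge-decomposed into factors if their edge sets partition $E(G)$. A bipartition $V_1,V_2$ of $V(G)$ here means a partition of the vertex set into two (possibly empty) disjoint parts; no condition on edges is implied. For a vertex set $A$, $d_G(A)$ is the number of edges of $G$ with exactly one end in $A$; $G$ is odd-$\lambda$-edge-connected if $d_G(A)\ge \lambda$ for every vertex set $A$ with $d_G(A)$ odd. *)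

theory Defs
  imports Complex_Main "HOL-Library.Uprod" "HOL-Library.Disjoint_Sets"
begin

text \<open>Undirected graphs with loops and multiple edges: edges are abstract objects, each with an
  unordered pair of ends; \<open>Upair v v\<close> is a loop at \<open>v\<close>. The map \<open>ends\<close> is only relevant on
  \<open>edges\<close>.\<close>

record ('v, 'e) multigraph =
  verts :: "'v set"
  edges :: "'e set"
  ends :: "'e \<Rightarrow> 'v uprod"

locale finite_multigraph =
  fixes G :: "('v, 'e) multigraph"
  assumes finite_verts: "finite (verts G)"
    and finite_edges: "finite (edges G)"
    and ends_in_verts: "\<And>e. e \<in> edges G \<Longrightarrow> set_uprod (ends G e) \<subseteq> verts G"

text \<open>A loop at \<open>v\<close> belongs to both sets, hence is counted twice.\<close>

definition degree :: "('v, 'e) multigraph \<Rightarrow> 'v \<Rightarrow> nat" where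
  "degree G v = card {e \<in> edges G. v \<in> set_uprod (ends G e)}
              + card {e \<in> edges G. ends G e = Upair v v}"

definition cut_edges :: "('v, 'e) multigraph \<Rightarrow> 'v set \<Rightarrow> 'e set" where
  "cut_edges G A = {e \<in> edges G. \<exists>x y. ends G e = Upair x y \<and> x \<in> A \<and> y \<notin> A}"

definition odd_edge_connected :: "nat \<Rightarrow> ('v, 'e) multigraph \<Rightarrow> bool" where
  "odd_edge_connected l G \<longleftrightarrow>
     (\<forall>A \<subseteq> verts G. odd (card (cut_edges G A)) \<longrightarrow> l \<le> card (cut_edges G A))"

definition is_factor :: "('v, 'e) multigraph \<Rightarrow> ('v, 'e) multigraph \<Rightarrow> bool" where
  "is_factor H G \<longleftrightarrow> verts H = verts G \<and> edges H \<subseteq> edges G \<and>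
     (\<forall>e \<in> edges H. ends H e = ends G e)"

text \<open>The factors are \<open>H 1, \<dots>, H k\<close>; some of them may have no edges.\<close>

definition factor_decomposition ::
    "('v, 'e) multigraph \<Rightarrow> nat \<Rightarrow> (nat \<Rightarrow> ('v, 'e) multigraph) \<Rightarrow> bool" where
  "factor_decomposition G k H \<longleftrightarrow>
     (\<forall>i \<in> {1..k}. is_factor (H i) G) \<and>
     disjoint_family_on (\<lambda>i. edges (H i)) {1..k} \<and>
     (\<Union>i \<in> {1..k}. edges (H i)) = edges G"

end

theory Submission
  imports Defs
begin

text \<open>
The proof splits the edge set in two again and again.  A single splitting is described by
\<open>parity_respecting_splitting\<close>: given a number \<open>r\<close> between \<open>0\<close> and \<open>1\<close> and a set \<open>U\<close> of vertices, there is a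
factor \<open>F\<close> with \<open>\<bar>d\<^sub>F(v) - r d\<^sub>G(v)\<bar> \<le> 1\<close> at all vertices outside \<open>U\<close>, and with error at most \<open>2\<close> and the
parity of \<open>d\<^sub>G(v)\<close> at the vertices of \<open>U\<close>.  The parities force \<open>F\<close> to meet the cut of every \<open>A \<subseteq> U\<close> with
\<open>d\<^sub>G(A)\<close> odd, and it suffices that the constant edge weight \<open>r\<close> already does so fractionally, that is,
\<open>r d\<^sub>G(A) \<ge> 1\<close>.  This condition is void if all vertices of \<open>U\<close> have even degree, which serves the general
splittings; and for \<open>r = \<epsilon>\<^sub>1\<close> and \<open>U = V\<^sub>2\<close> it is what odd edge-connectivity provides.

Such a factor is a perfect matching of an auxiliary graph in which each vertex is replaced by a gadget
(\<open>degree_gadget\<close>).  If there is none, the Tutte--Berge formula (\<open>card_missed_le_barrier\<close>, proved by means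
of Gallai's lemma) gives a set \<open>S\<close> of nodes whose removal leaves too many odd parts.  Choosing \<open>S\<close> minimal
forces it to respect the gadgets, and a discharging argument with the weights \<open>r\<close> and \<open>1 - r\<close> shows that
\<open>S\<close> pays one unit to every odd part with at most one exception; parity excludes the exception.

To obtain \<open>k\<close> factors, splittings are arranged so that errors do not accumulate
(\<open>parts_of_bounded_error\<close>).  A group of indices with error below \<open>3q\<close> may be divided into two groups
having each at most two thirds of its weight, since \<open>2/3 * 3q + q = 3q\<close>.  Grouping weights that differ by a
factor of at most two leads to such divisions, until the heaviest weight is at least the sum of the
others; then it is split off, and the error of the remainder stays below \<open>2q\<close>.  At a vertex of \<open>V\<^sub>2\<close> every
splitting leaves at most one part odd.  For the second claim the factor with index \<open>1\<close> is split off first,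
with all parities of \<open>G\<close> on \<open>V\<^sub>2\<close>, so that the remainder is even there.
\<close>


section \<open>Maximum matchings\<close>

lemma even_card_of_involution:
  assumes "finite A"
    and "\<And>x. x \<in> A \<Longrightarrow> g x \<in> A \<and> g (g x) = x \<and> g x \<noteq> x"
  shows "even (card A)"
  using assms
proof (induction A rule: finite_psubset_induct)
  case (psubset A)
  show ?case
  proof (cases "A = {}")
    case False
    then obtain x where x: "x \<in> A" by blast
    have g: "g x \<in> A" "g (g x) = x" "g x \<noteq> x" using psubset.prems x by auto
    have "even (card (A - {x, g x}))"
    proof (rule psubset.IH)
      show "A - {x, g x} \<subset> A" using x by blast
      show "g y \<in> A - {x, g x} \<and> g (g y) = y \<and> g y \<noteq> y" if "y \<in> A - {x, g x}" for y
        using psubset.prems[of y] g that by auto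
    qed
    moreover have "card (A - {x, g x}) = card A - 2"
      using x g psubset.hyps by (subst card_Diff_subset) auto
    moreover have "card A \<ge> 2"
      using card_mono[of A "{x, g x}"] x g psubset.hyps by auto
    ultimately show ?thesis by simp
  qed simp
qed

text \<open>A matching is encoded as the involution that exchanges the two ends of each of its edges and fixes
the vertices it misses.  Both augmenting a matching and rotating one of its edges are then plain
function updates.\<close>

definition matching_on :: "'a set \<Rightarrow> ('a \<Rightarrow> 'a \<Rightarrow> bool) \<Rightarrow> ('a \<Rightarrow> 'a) \<Rightarrow> bool" where
  "matching_on W adj M \<longleftrightarrow>
     (\<forall>x\<in>W. M x \<in> W \<and> M (M x) = x \<and> (M x \<noteq> x \<longrightarrow> adj x (M x)))"

definition missed :: "'a set \<Rightarrow> ('a \<Rightarrow> 'a) \<Rightarrow> 'a set" where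
  "missed W M = {x \<in> W. M x = x}"

definition maximum_matching_on :: "'a set \<Rightarrow> ('a \<Rightarrow> 'a \<Rightarrow> bool) \<Rightarrow> ('a \<Rightarrow> 'a) \<Rightarrow> bool" where
  "maximum_matching_on W adj M \<longleftrightarrow> matching_on W adj M \<and>
     (\<forall>N. matching_on W adj N \<longrightarrow> card (missed W M) \<le> card (missed W N))"

text \<open>The members of \<open>\<C>\<close> are unions of components of the graph without \<open>S\<close>.  They may be disconnected, so
that parts of an equivalence relation qualify without any analysis of connectivity.\<close>

definition odd_barrier :: "'a set \<Rightarrow> ('a \<Rightarrow> 'a \<Rightarrow> bool) \<Rightarrow> 'a set \<Rightarrow> 'a set set \<Rightarrow> bool" where
  "odd_barrier W adj S \<C> \<longleftrightarrow> S \<subseteq> W \<and> partition_on (W - S) \<C> \<and> (\<forall>C\<in>\<C>. odd (card C)) \<and>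
     (\<forall>C\<in>\<C>. \<forall>x\<in>C. \<forall>y\<in>W - S. adj x y \<longrightarrow> y \<in> C)"

lemma matching_onD:
  assumes "matching_on W adj M" "x \<in> W"
  shows "M x \<in> W" "M (M x) = x" "M x \<noteq> x \<Longrightarrow> adj x (M x)"
  using assms unfolding matching_on_def by auto

lemma matching_inj: "\<lbrakk>matching_on W adj M; x \<in> W; y \<in> W; M x = M y\<rbrakk> \<Longrightarrow> x = y"
  using matching_onD(2) by metis

lemma finite_missed [simp]: "finite W \<Longrightarrow> finite (missed W M)"
  unfolding missed_def by simp

lemma parity_missed:
  assumes "finite W" "\<And>x. x \<in> W \<Longrightarrow> M x \<in> W \<and> M (M x) = x"
  shows "even (card (missed W M)) \<longleftrightarrow> even (card W)"
proof -
  have "even (card (W - missed W M))"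
    by (rule even_card_of_involution[where g = M]) (use assms in \<open>auto simp: missed_def\<close>)
  moreover have "card W = card (missed W M) + card (W - missed W M)"
    using assms(1) by (subst card_Un_disjoint[symmetric]) (auto simp: missed_def intro: arg_cong[of _ _ card])
  ultimately show ?thesis by simp
qed

lemma ex_maximum_matching: "\<exists>M. maximum_matching_on W adj M"
proof -
  have id: "matching_on W adj (\<lambda>x. x)" unfolding matching_on_def by simp
  show ?thesis
    using ex_has_least_nat[of "matching_on W adj" _ "\<lambda>M. card (missed W M)", OF id]
    unfolding maximum_matching_on_def by blast
qed

lemma maximum_matching_missed_not_adj:
  assumes fin: "finite W" and sym: "\<And>x y. adj x y \<Longrightarrow> adj y x"
    and M: "maximum_matching_on W adj M" and x: "x \<in> missed W M" and y: "y \<in> missed W M" "x \<noteq> y"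
  shows "\<not> adj x y"
proof
  assume xy: "adj x y"
  let ?N = "M(x := y, y := x)"
  have m: "matching_on W adj M" using M unfolding maximum_matching_on_def by simp
  have inW: "x \<in> W" "y \<in> W" "M x = x" "M y = y" using x y unfolding missed_def by auto
  have other: "M z \<noteq> x \<and> M z \<noteq> y" if "z \<in> W" "z \<noteq> x" "z \<noteq> y" for z
    using matching_onD(2)[OF m that(1)] inW that by metis
  have "matching_on W adj ?N"
    unfolding matching_on_def
    using matching_onD[OF m] inW xy sym[OF xy] y(2) other by auto
  moreover have "missed W ?N \<subset> missed W M"
    using x y unfolding missed_def by auto
  then have "card (missed W ?N) < card (missed W M)"
    using fin by (intro psubset_card_mono) auto
  ultimately show False using M unfolding maximum_matching_on_def by fastforce
qed

text \<open>Gallai's lemma.  Suppose that a maximum matching \<open>M\<close> misses both \<open>u\<close> and \<open>v\<close>, and let \<open>N\<close> be a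
maximum matching missing \<open>t\<close> that agrees with \<open>M\<close> as much as possible.  Then \<open>N\<close> covers \<open>u\<close> and
\<open>v\<close>; both matchings miss equally many vertices, so \<open>N\<close> misses two vertices covered by \<open>M\<close>, one of
which, \<open>x\<close>, is not \<open>t\<close>.  Replacing the \<open>N\<close>-edge at the \<open>M\<close>-partner of \<open>x\<close> by the \<open>M\<close>-edge at \<open>x\<close>
keeps the size and still misses \<open>t\<close>, yet agrees more with \<open>M\<close>.\<close>

lemma gallai_transitive:
  assumes fin: "finite W" and sym: "\<And>x y. adj x y \<Longrightarrow> adj y x"
    and all_missed: "\<And>w. w \<in> W \<Longrightarrow> \<exists>M. maximum_matching_on W adj M \<and> w \<in> missed W M"
    and W: "t \<in> W"
    and ut: "\<And>M. maximum_matching_on W adj M \<Longrightarrow> \<not> (u \<in> missed W M \<and> t \<in> missed W M)"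
    and tv: "\<And>M. maximum_matching_on W adj M \<Longrightarrow> \<not> (t \<in> missed W M \<and> v \<in> missed W M)"
    and uv: "u \<noteq> v" and M: "maximum_matching_on W adj M"
  shows "\<not> (u \<in> missed W M \<and> v \<in> missed W M)"
proof
  assume Muv: "u \<in> missed W M \<and> v \<in> missed W M"
  define agree where "agree N = {x \<in> W. M x = N x}" for N
  have bound: "card (agree N) \<le> card W" for N
    unfolding agree_def using fin by (intro card_mono) auto
  obtain N0 where "maximum_matching_on W adj N0 \<and> t \<in> missed W N0" using all_missed[OF W] by blast
  then obtain N where N: "maximum_matching_on W adj N" "t \<in> missed W N"
    and N_best: "\<And>N'. maximum_matching_on W adj N' \<Longrightarrow> t \<in> missed W N' \<Longrightarrow> card (agree N') \<le> card (agree N)"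
    using ex_has_greatest_nat[of "\<lambda>N. maximum_matching_on W adj N \<and> t \<in> missed W N" N0
        "\<lambda>N. card (agree N)" "Suc (card W)"] bound
    by (auto simp: less_Suc_eq_le)
  have mM: "matching_on W adj M" and mN: "matching_on W adj N"
    using M N unfolding maximum_matching_on_def by auto
  have card_eq: "card (missed W M) = card (missed W N)"
    using M N mM mN unfolding maximum_matching_on_def by (meson le_antisym)
  have "u \<notin> missed W N" "v \<notin> missed W N" using ut[OF N(1)] tv[OF N(1)] N(2) by auto
  then have "2 \<le> card (missed W M - missed W N)"
    using card_mono[of "missed W M - missed W N" "{u, v}"] Muv uv fin by auto
  also have "card (missed W M - missed W N) = card (missed W N - missed W M)"
    using card_eq fin by (metis card_le_sym_Diff le_antisym order_refl finite_missed)
  finally have two: "2 \<le> card (missed W N - missed W M)" .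
  obtain x where x: "x \<in> missed W N" "x \<notin> missed W M" "x \<noteq> t"
  proof -
    have "\<not> missed W N - missed W M \<subseteq> {t}"
      using two card_mono[of "{t}" "missed W N - missed W M"] by auto
    then show ?thesis using that by blast
  qed
  define y where "y = M x"
  define z where "z = N y"
  have xW: "x \<in> W" "N x = x" "y \<noteq> x" using x unfolding missed_def y_def by auto
  have yW: "y \<in> W" "M y = x" "adj x y" using matching_onD[OF mM xW(1)] xW unfolding y_def by auto
  have "y \<notin> missed W N"
    using maximum_matching_missed_not_adj[OF fin sym N(1) x(1)] yW(3) xW(3) by metis
  then have zy: "z \<noteq> y" using yW unfolding missed_def z_def by auto
  have zW: "z \<in> W" "N z = y" using matching_onD[OF mN yW(1)] unfolding z_def by auto
  have zx: "z \<noteq> x" using zW xW by metis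
  have tN: "t \<noteq> y" "t \<noteq> z" "N t = t" using N(2) zy zW unfolding missed_def z_def by auto
  define N' where "N' = N(x := y, y := x, z := z)"
  have other: "N w \<noteq> x \<and> N w \<noteq> y \<and> N w \<noteq> z" if "w \<in> W" "w \<noteq> x" "w \<noteq> y" "w \<noteq> z" for w
    using matching_onD(2)[OF mN that(1)] xW zW that unfolding z_def by metis
  have mN': "matching_on W adj N'"
    unfolding matching_on_def N'_def
    using matching_onD[OF mN] xW yW zW zx zy sym[OF yW(3)] other by auto
  have "missed W N' = insert z (missed W N - {x})"
    using xW yW zW zx zy z_def[symmetric] unfolding missed_def N'_def by auto
  moreover have "z \<notin> missed W N" using zW zy unfolding missed_def by auto
  ultimately have "card (missed W N') = card (missed W N)"
    using x fin by (simp add: card_gt_0_iff) (metis Suc_pred card_gt_0_iff empty_iff finite_missed)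
  then have max': "maximum_matching_on W adj N'"
    using N(1) mN' unfolding maximum_matching_on_def by simp
  have "t \<in> missed W N'" using tN x(3) W unfolding missed_def N'_def by auto
  then have "card (agree N') \<le> card (agree N)" using N_best max' by blast
  moreover have "agree N \<subset> agree N'"
  proof -
    have "M z \<noteq> y" using matching_inj[OF mM xW(1) zW(1)] zx unfolding y_def by metis
    then have "agree N \<subseteq> agree N'"
      unfolding agree_def N'_def using xW yW zW zx zy y_def by auto
    moreover have "x \<in> agree N'" "x \<notin> agree N"
      unfolding agree_def N'_def using xW zx y_def by auto
    ultimately show ?thesis by blast
  qed
  then have "card (agree N) < card (agree N')"
    using fin unfolding agree_def by (intro psubset_card_mono) auto
  ultimately show False by simp
qed

section \<open>The Tutte--Berge formula and minimal barriers\<close>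

text \<open>By \<open>gallai_transitive\<close>, "no maximum matching misses both" is an equivalence relation, and it contains
adjacency.  A maximum matching that misses \<open>u\<close> pairs off the rest of the class of \<open>u\<close>, so the
classes are odd; and the vertices missed by \<open>M\<close> lie in distinct classes.\<close>

lemma odd_classes_if_all_missed:
  assumes fin: "finite W" and sym: "\<And>x y. adj x y \<Longrightarrow> adj y x"
    and all_missed: "\<And>w. w \<in> W \<Longrightarrow> \<exists>M. maximum_matching_on W adj M \<and> w \<in> missed W M"
    and M: "maximum_matching_on W adj M"
  shows "\<exists>\<C>. odd_barrier W adj {} \<C> \<and> card (missed W M) \<le> card \<C>"
proof -
  define R where "R = {(x, y). x \<in> W \<and> y \<in> W \<and>
      (x = y \<or> (\<forall>N. maximum_matching_on W adj N \<longrightarrow> \<not> (x \<in> missed W N \<and> y \<in> missed W N)))}"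
  have "trans R"
  proof (rule transI)
    fix x y z assume "(x, y) \<in> R" "(y, z) \<in> R"
    then show "(x, z) \<in> R"
      using gallai_transitive[where t = y and u = x and v = z, OF fin sym all_missed]
      unfolding R_def by blast
  qed
  then have eq: "equiv W R"
    by (intro equivI) (auto simp: R_def refl_on_def sym_def)
  have adjR: "(x, y) \<in> R" if "x \<in> W" "y \<in> W" "adj x y" for x y
    using maximum_matching_missed_not_adj[where adj = adj and x = x and y = y, OF fin sym] that unfolding R_def by blast
  have "odd (card C)" if C: "C \<in> W // R" for C
  proof -
    obtain u where u: "u \<in> W" "C = R `` {u}" using C by (rule quotientE)
    obtain N where N: "maximum_matching_on W adj N" "u \<in> missed W N" using all_missed[OF u(1)] by blast
    have mN: "matching_on W adj N" and Nu: "N u = u"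
      using N unfolding maximum_matching_on_def missed_def by auto
    have uC: "u \<in> C" "C \<subseteq> W" using u unfolding R_def by auto
    have "even (card (C - {u}))"
    proof (rule even_card_of_involution[where g = N])
      show "finite (C - {u})" using uC fin finite_subset by blast
      fix x assume x: "x \<in> C - {u}"
      have xW: "x \<in> W" and ux: "(u, x) \<in> R" using x uC u by auto
      have ne: "N x \<noteq> x" using x ux N xW unfolding R_def missed_def by auto
      have "(x, N x) \<in> R" using adjR matching_onD[OF mN xW] xW ne by blast
      then have "N x \<in> C" using ux \<open>trans R\<close> u(2) by (auto dest: transD)
      moreover have "N x \<noteq> u" using matching_onD(2)[OF mN xW] Nu x by auto
      ultimately show "N x \<in> C - {u} \<and> N (N x) = x \<and> N x \<noteq> x"
        using ne matching_onD(2)[OF mN xW] by blast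
    qed
    moreover have "card C = Suc (card (C - {u}))"
      using uC fin finite_subset card.remove by metis
    ultimately show ?thesis by simp
  qed
  moreover have "y \<in> C" if "C \<in> W // R" "x \<in> C" "y \<in> W" "adj x y" for C x y
  proof -
    have "x \<in> W" using that eq in_quotient_imp_subset by blast
    then show ?thesis using that adjR in_quotient_imp_closed[OF eq] by blast
  qed
  ultimately have "odd_barrier W adj {} (W // R)"
    unfolding odd_barrier_def using partition_on_quotient[OF eq] by auto
  moreover have "card (missed W M) \<le> card (W // R)"
  proof (rule card_inj_on_le)
    show "inj_on (\<lambda>x. R `` {x}) (missed W M)"
    proof (rule inj_onI)
      fix x y assume xy: "x \<in> missed W M" "y \<in> missed W M" "R `` {x} = R `` {y}"
      then have "(x, y) \<in> R" using eq_equiv_class[OF xy(3) eq] unfolding missed_def by auto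
      then show "x = y" using xy M unfolding R_def by blast
    qed
    show "(\<lambda>x. R `` {x}) ` missed W M \<subseteq> W // R"
      unfolding missed_def by (auto intro: quotientI)
    show "finite (W // R)" using fin eq by (simp add: finite_quotient equiv_type)
  qed
  ultimately show ?thesis by blast
qed

text \<open>The hard half of the Tutte--Berge formula.  If some \<open>v\<close> is covered by every maximum matching, then
deleting \<open>v\<close> increases the deficiency by one and \<open>v\<close> joins the barrier of the smaller graph;
otherwise the previous lemma applies with the empty barrier.\<close>

lemma card_missed_le_barrier:
  assumes "finite W" and sym: "\<And>x y. adj x y \<Longrightarrow> adj y x"
    and "maximum_matching_on W adj M"
  shows "\<exists>S \<C>. odd_barrier W adj S \<C> \<and> card (missed W M) + card S \<le> card \<C>"
  using assms(1,3)
proof (induction W arbitrary: M rule: finite_psubset_induct)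
  case (psubset W)
  show ?case
  proof (cases "\<forall>w\<in>W. \<exists>M. maximum_matching_on W adj M \<and> w \<in> missed W M")
    case True
    then obtain \<C> where "odd_barrier W adj {} \<C>" "card (missed W M) \<le> card \<C>"
      using odd_classes_if_all_missed[OF psubset.hyps sym _ psubset.prems] by blast
    then show ?thesis by (intro exI[of _ "{}"] exI[of _ \<C>]) simp
  next
    case False
    then obtain v where v: "v \<in> W" "\<And>N. maximum_matching_on W adj N \<Longrightarrow> v \<notin> missed W N" by blast
    obtain N where N: "maximum_matching_on (W - {v}) adj N" using ex_maximum_matching by blast
    obtain S \<C> where IH: "odd_barrier (W - {v}) adj S \<C>"
      "card (missed (W - {v}) N) + card S \<le> card \<C>"
      using psubset.IH[OF _ N] v by blast
    have mN: "matching_on (W - {v}) adj N" and mM: "matching_on W adj M"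
      using N psubset.prems unfolding maximum_matching_on_def by auto
    have mN': "matching_on W adj (N(v := v))"
      using mN unfolding matching_on_def by auto
    have miss: "missed W (N(v := v)) = insert v (missed (W - {v}) N)"
      using v unfolding missed_def by auto
    then have card_miss: "card (missed W (N(v := v))) = Suc (card (missed (W - {v}) N))"
      using psubset.hyps unfolding missed_def by (subst miss[unfolded missed_def]) auto
    (* A matching missing v is not maximum, and by parity it misses at least two vertices too many. *)
    have "\<not> maximum_matching_on W adj (N(v := v))" using v(2) miss by blast
    then have "card (missed W M) < card (missed W (N(v := v)))"
      using mN' psubset.prems unfolding maximum_matching_on_def
      by (meson le_trans not_le_imp_less)
    moreover have "even (card (missed W M)) \<longleftrightarrow> even (card (missed W (N(v := v))))"
      using parity_missed[OF psubset.hyps, of M] parity_missed[OF psubset.hyps, of "N(v := v)"]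
        matching_onD[OF mM] matching_onD[OF mN'] by auto
    ultimately have le: "card (missed W M) + 1 \<le> card (missed (W - {v}) N)"
      using card_miss by (cases "card (missed W M) = card (missed (W - {v}) N)") auto
    have S: "S \<subseteq> W - {v}" "finite S"
      using IH(1) psubset.hyps unfolding odd_barrier_def by (auto intro: finite_subset)
    have "W - {v} - S = W - insert v S" by auto
    then have "odd_barrier W adj (insert v S) \<C>"
      using IH(1) v(1) unfolding odd_barrier_def by auto
    moreover have "v \<notin> S" using S by blast
    then have "card (insert v S) = Suc (card S)" using S by simp
    ultimately show ?thesis using le IH(2) by (intro exI[of _ "insert v S"] exI[of _ \<C>]) auto
  qed
qed

lemma odd_barrier_finite:
  assumes "finite W" "odd_barrier W adj S \<C>"
  shows "finite S" "finite \<C>" "\<And>C. C \<in> \<C> \<Longrightarrow> finite C"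
  using assms unfolding odd_barrier_def
  by (auto intro: finite_subset finite_elements simp: partition_on_def)

text \<open>In a barrier with \<open>S\<close> as small as possible, each \<open>s \<in> S\<close> has neighbours in three members of \<open>\<C>\<close>.
Otherwise \<open>s\<close> and two members containing all its neighbours outside \<open>S\<close> merge into one odd set, which
lowers \<open>card S\<close> and \<open>card \<C>\<close> by one each.  Parity of the number of vertices supplies the surplus of
two.\<close>

lemma minimal_barrier:
  assumes fin: "finite W" and sym: "\<And>x y. adj x y \<Longrightarrow> adj y x" and "even (card W)"
    and no_perfect: "\<And>M. matching_on W adj M \<Longrightarrow> missed W M \<noteq> {}"
  obtains S \<C> where "odd_barrier W adj S \<C>" "card S + 2 \<le> card \<C>"
    and "\<And>s A B. s \<in> S \<Longrightarrow> A \<in> \<C> \<Longrightarrow> B \<in> \<C> \<Longrightarrow> \<exists>x \<in> W - S. adj s x \<and> x \<notin> A \<union> B"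
proof -
  define good where "good S \<longleftrightarrow> (\<exists>\<C>. odd_barrier W adj S \<C> \<and> card S + 2 \<le> card \<C>)" for S
  have "\<exists>S. good S"
  proof -
    obtain M where M: "maximum_matching_on W adj M" using ex_maximum_matching by blast
    then have m: "matching_on W adj M" unfolding maximum_matching_on_def by simp
    obtain S \<C> where "odd_barrier W adj S \<C>" "card (missed W M) + card S \<le> card \<C>"
      using card_missed_le_barrier[OF fin sym M] by blast
    moreover have "card (missed W M) \<noteq> 0" using no_perfect[OF m] fin by simp
    moreover have "even (card (missed W M))"
      using parity_missed[OF fin] matching_onD[OF m] assms(3) by blast
    then have "card (missed W M) \<noteq> 1" by auto
    ultimately show ?thesis unfolding good_def by (intro exI[of _ S] exI[of _ \<C>]) auto
  qed
  then obtain S where "good S" and least: "\<And>S'. good S' \<Longrightarrow> card S \<le> card S'"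
    using ex_has_least_nat[of good _ card] by blast
  then obtain \<C> where \<C>: "odd_barrier W adj S \<C>" "card S + 2 \<le> card \<C>" unfolding good_def by blast
  note finS = odd_barrier_finite[OF fin \<C>(1)]
  have part: "partition_on (W - S) \<C>" and SW: "S \<subseteq> W"
    and odd: "\<And>C. C \<in> \<C> \<Longrightarrow> odd (card C)"
    and closed: "\<And>C x y. C \<in> \<C> \<Longrightarrow> x \<in> C \<Longrightarrow> y \<in> W - S \<Longrightarrow> adj x y \<Longrightarrow> y \<in> C"
    using \<C>(1) unfolding odd_barrier_def by auto
  have "\<exists>x \<in> W - S. adj s x \<and> x \<notin> A \<union> B" if s: "s \<in> S" and AB: "A \<in> \<C>" "B \<in> \<C>" for s A B
  proof (rule ccontr)
    assume no: "\<not> ?thesis"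
    obtain B' where B': "B' \<in> \<C>" "A \<noteq> B'" "A \<union> B \<subseteq> A \<union> B'"
    proof (cases "A = B")
      case True
      have "\<not> \<C> \<subseteq> {A}" using \<C>(2) card_mono[of "{A}" \<C>] by auto
      then show ?thesis using that True by blast
    qed (use that AB in blast)
    define D where "D = insert s (A \<union> B')"
    define \<C>' where "\<C>' = insert D (\<C> - {A, B'})"
    have sub: "A \<subseteq> W - S" "B' \<subseteq> W - S" using part AB B' unfolding partition_on_def by auto
    have dis: "P \<inter> Q = {}" if "P \<in> \<C>" "Q \<in> \<C>" "P \<noteq> Q" for P Q
      using part that unfolding partition_on_def disjoint_def by blast
    have disj: "A \<inter> B' = {}" using dis AB B' by blast
    have sD: "s \<notin> A \<union> B'" using sub s by auto
    have cardD: "card D = Suc (card A + card B')"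
      unfolding D_def using sD finS(3) AB B' disj by (simp add: card_Un_disjoint)
    have Dnew: "D \<notin> \<C>" using part s unfolding partition_on_def D_def by auto
    have nbrs: "x \<in> A \<union> B'" if "x \<in> W - S" "adj s x" for x using no that B'(3) by blast
    have "partition_on (W - (S - {s})) \<C>'"
    proof (rule partition_onI)
      show "\<Union> \<C>' = W - (S - {s})"
      proof -
        have "\<Union> \<C>' = insert s (\<Union> \<C>)" unfolding \<C>'_def D_def using AB B' by auto
        then show ?thesis using part s SW unfolding partition_on_def by auto
      qed
      have "disjnt D C" if "C \<in> \<C> - {A, B'}" for C
      proof -
        have "A \<inter> C = {}" "B' \<inter> C = {}" "s \<notin> C"
          using that dis[of A C] dis[of B' C] AB B' s part unfolding partition_on_def by auto
        then show ?thesis unfolding D_def disjnt_def by auto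
      qed
      then show "disjnt p q" if "p \<in> \<C>'" "q \<in> \<C>'" "p \<noteq> q" for p q
        using that part unfolding \<C>'_def partition_on_def disjoint_def
        by (metis Diff_iff disjnt_def disjnt_sym insert_iff)
      show "{} \<notin> \<C>'" using part unfolding \<C>'_def D_def partition_on_def by auto
    qed
    moreover have "odd (card C)" if "C \<in> \<C>'" for C
      using that odd AB B' cardD unfolding \<C>'_def by auto
    moreover have "y \<in> C" if C: "C \<in> \<C>'" "x \<in> C" and y: "y \<in> W - (S - {s})" "adj x y" for C x y
    proof (cases "C = D")
      case True
      show ?thesis
      proof (cases "y = s \<or> x = s")
        case True then show ?thesis using \<open>C = D\<close> nbrs y unfolding D_def by auto
      next
        case False
        then show ?thesis using \<open>C = D\<close> C y closed AB B' unfolding D_def by blast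
      qed
    next
      case False
      then have CC: "C \<in> \<C>" "C \<noteq> A" "C \<noteq> B'" using C unfolding \<C>'_def by auto
      then have "x \<in> W - S" "x \<notin> A \<union> B'"
        using C(2) part dis[of C A] dis[of C B'] AB B' unfolding partition_on_def by auto
      then have "y \<noteq> s" using nbrs sym[OF y(2)] by blast
      then show ?thesis using closed CC C y by blast
    qed
    ultimately have "odd_barrier W adj (S - {s}) \<C>'"
      unfolding odd_barrier_def using SW by auto
    moreover have "card \<C>' = card \<C> - 1"
      unfolding \<C>'_def using finS(2) Dnew AB B' \<C>(2) by (simp add: card_Diff_subset)
    moreover have "card (S - {s}) = card S - 1" "card S \<ge> 1"
      using s finS(1) by (auto simp: Suc_le_eq card_gt_0_iff)
    ultimately have "good (S - {s})" unfolding good_def using \<C>(2) by (intro exI[of _ \<C>']) auto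
    then show False using least[of "S - {s}"] \<open>card (S - {s}) = card S - 1\<close> \<open>card S \<ge> 1\<close> by simp
  qed
  then show ?thesis using that \<C> by blast
qed

section \<open>Prescribed degrees by perfect matchings\<close>

text \<open>The gadget graph that turns degree prescriptions into perfect matchings.  A port is a half-edge; it is
matched either to the other half of its edge, which is then selected, or to a core node of its vertex.
A vertex \<open>v\<close> of degree \<open>d v\<close> gets \<open>d v - f v\<close> mandatory core nodes, which only ports can cover,
followed by its optional ones.  On \<open>U\<close> there are two optional nodes joined by an edge: they use up either
no port or two, and so the selected degree is \<open>f v\<close> or \<open>f v - 2\<close>.  Elsewhere there is a single optional
node, and all these nodes form a clique in which they can be paired off: the selected degree is \<open>f v\<close> or
\<open>f v - 1\<close>.  The node \<open>Extra\<close> joins this clique when the total number of nodes would be odd.\<close>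

datatype ('p, 'v) node = Port 'p | Core 'v nat | Extra

text \<open>The last assumption is the only global one: a selection with the parities of the degrees on \<open>U\<close>
  meets every odd cut of a set \<open>A \<subseteq> U\<close>, and the constant edge weight \<open>r\<close> is required to give such a cut
  total weight at least one.\<close>

locale degree_gadget =
  fixes P :: "'p set" and mate :: "'p \<Rightarrow> 'p" and base :: "'p \<Rightarrow> 'v"
    and V U :: "'v set" and f :: "'v \<Rightarrow> nat" and r :: real
  assumes finite_P: "finite P" and finite_V: "finite V" and U_subset: "U \<subseteq> V"
    and mate: "\<And>p. p \<in> P \<Longrightarrow> mate p \<in> P" "\<And>p. p \<in> P \<Longrightarrow> mate (mate p) = p"
      "\<And>p. p \<in> P \<Longrightarrow> mate p \<noteq> p"
    and at_V: "\<And>p. p \<in> P \<Longrightarrow> base p \<in> V"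
    and r01: "0 \<le> r" "r \<le> 1"
    and f_le: "\<And>v. v \<in> V \<Longrightarrow> f v \<le> card {p \<in> P. base p = v}"
    and f_ge: "\<And>v. v \<in> V \<Longrightarrow> r * real (card {p \<in> P. base p = v}) \<le> real (f v)"
    and f_lower: "\<And>v. v \<in> V \<Longrightarrow>
      real (f v) - (if v \<in> U then 2 else 1) \<le> r * real (card {p \<in> P. base p = v})"
    and f_parity: "\<And>v. v \<in> U \<Longrightarrow> even (f v) \<longleftrightarrow> even (card {p \<in> P. base p = v})"
    and odd_cut: "\<And>A. A \<subseteq> U \<Longrightarrow> odd (card {p \<in> P. base p \<in> A \<and> base (mate p) \<notin> A}) \<Longrightarrow>
      1 \<le> r * real (card {p \<in> P. base p \<in> A \<and> base (mate p) \<notin> A})"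
begin

definition d :: "'v \<Rightarrow> nat" where "d v = card {p \<in> P. base p = v}"
definition opt :: "'v \<Rightarrow> nat" where "opt v = (if v \<in> U then 2 else 1)"
definition m :: "'v \<Rightarrow> nat" where "m v = d v - f v"

definition cores :: "'v \<Rightarrow> ('p, 'v) node set" where
  "cores v = Core v ` {..<m v + opt v}"

definition proper_nodes :: "('p, 'v) node set" where
  "proper_nodes = Port ` P \<union> (\<Union>v\<in>V. cores v)"

definition nodes :: "('p, 'v) node set" where
  "nodes = proper_nodes \<union> (if even (card proper_nodes) then {} else {Extra})"

fun adj :: "('p, 'v) node \<Rightarrow> ('p, 'v) node \<Rightarrow> bool" where
  "adj (Port p) (Port q) \<longleftrightarrow> p \<in> P \<and> q = mate p"
| "adj (Port p) (Core v n) \<longleftrightarrow> base p = v"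
| "adj (Core v n) (Port p) \<longleftrightarrow> base p = v"
| "adj (Core v n) (Core w k) \<longleftrightarrow>
     v = w \<and> v \<in> U \<and> (n = m v \<and> k = Suc (m v) \<or> k = m v \<and> n = Suc (m v)) \<or>
     v \<noteq> w \<and> v \<notin> U \<and> w \<notin> U \<and> n = m v \<and> k = m w"
| "adj (Core v n) Extra \<longleftrightarrow> v \<notin> U \<and> n = m v"
| "adj Extra (Core v n) \<longleftrightarrow> v \<notin> U \<and> n = m v"
| "adj (Port p) Extra \<longleftrightarrow> False"
| "adj Extra (Port p) \<longleftrightarrow> False"
| "adj Extra Extra \<longleftrightarrow> False"

fun free :: "('p, 'v) node \<Rightarrow> bool" where
  "free (Port p) \<longleftrightarrow> False"
| "free (Core v n) \<longleftrightarrow> v \<notin> U \<and> n = m v"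
| "free Extra \<longleftrightarrow> True"

lemma adj_sym: "adj x y \<Longrightarrow> adj y x"
  by (cases x; cases y) (auto simp: mate)

lemma free_adj: "free x \<Longrightarrow> free y \<Longrightarrow> x = y \<or> adj x y"
  by (cases x; cases y) auto

lemma nonport_neighbours_adj:
  "adj x y \<Longrightarrow> adj x z \<Longrightarrow> \<forall>p. x \<noteq> Port p \<Longrightarrow> \<forall>p. y \<noteq> Port p \<Longrightarrow> \<forall>p. z \<noteq> Port p \<Longrightarrow> y = z \<or> adj y z"
  by (cases x; cases y; cases z) auto

lemma finite_proper: "finite proper_nodes"
  unfolding proper_nodes_def cores_def using finite_P finite_V by auto

lemma finite_nodes: "finite nodes"
  unfolding nodes_def using finite_proper by auto

lemma even_nodes: "even (card nodes)"
proof -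
  have "Extra \<notin> proper_nodes" unfolding proper_nodes_def cores_def by auto
  then show ?thesis unfolding nodes_def using finite_proper by auto
qed

lemma Port_in_nodes [simp]: "Port p \<in> nodes \<longleftrightarrow> p \<in> P"
  unfolding nodes_def proper_nodes_def cores_def by auto

lemma Core_in_nodes [simp]: "Core v n \<in> nodes \<longleftrightarrow> v \<in> V \<and> n < m v + opt v"
  unfolding nodes_def proper_nodes_def cores_def by auto

lemma even_m: "v \<in> U \<Longrightarrow> even (m v)"
  using f_parity f_le U_subset unfolding m_def d_def by auto

lemma card_ports_at:
  assumes "T \<subseteq> V"
  shows "card {p \<in> P. base p \<in> T} = (\<Sum>v\<in>T. d v)"
proof -
  have "{p \<in> P. base p \<in> T} = (\<Union>v\<in>T. {p \<in> P. base p = v})" by auto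
  also have "card \<dots> = (\<Sum>v\<in>T. d v)"
    unfolding d_def using assms finite_V finite_P
    by (intro card_UN_disjoint) (auto intro: finite_subset)
  finally show ?thesis .
qed

end

text \<open>The kind of barrier that a gadget graph without a perfect matching would have, by \<open>minimal_barrier\<close>;
  \<open>no_large_minimal_barrier\<close> refutes it.\<close>

locale gadget_barrier = degree_gadget +
  fixes S :: "('a, 'b) node set" and \<C> :: "('a, 'b) node set set"
  assumes barrier: "odd_barrier nodes adj S \<C>" and large: "card S + 2 \<le> card \<C>"
    and three: "\<And>s A B. s \<in> S \<Longrightarrow> A \<in> \<C> \<Longrightarrow> B \<in> \<C> \<Longrightarrow> \<exists>x \<in> nodes - S. adj s x \<and> x \<notin> A \<union> B"
begin

lemma S_nodes: "S \<subseteq> nodes" and part: "partition_on (nodes - S) \<C>"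
  and odd_member: "C \<in> \<C> \<Longrightarrow> odd (card C)"
  and closed: "C \<in> \<C> \<Longrightarrow> x \<in> C \<Longrightarrow> y \<in> nodes - S \<Longrightarrow> adj x y \<Longrightarrow> y \<in> C"
  using barrier unfolding odd_barrier_def by auto

lemma member_subset: "C \<in> \<C> \<Longrightarrow> C \<subseteq> nodes - S"
  using part unfolding partition_on_def by auto

lemma member_finite: "C \<in> \<C> \<Longrightarrow> finite C"
  using member_subset finite_nodes by (meson finite_Diff finite_subset)

lemma finite_members: "finite \<C>"
  using odd_barrier_finite[OF finite_nodes barrier] by simp

text \<open>Outside \<open>nodes - S\<close> the value is an arbitrary member of \<open>\<C>\<close>, so that assumption \<open>three\<close> can be applied
to \<open>cls x\<close> even when \<open>x\<close> lies in \<open>S\<close>.\<close>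

definition cls :: "('a, 'b) node \<Rightarrow> ('a, 'b) node set" where
  "cls x = (if x \<in> nodes - S then SOME C. C \<in> \<C> \<and> x \<in> C else SOME C. C \<in> \<C>)"

lemma cls_member: "cls x \<in> \<C>" and cls_self: "x \<in> nodes - S \<Longrightarrow> x \<in> cls x"
proof -
  have "\<C> \<noteq> {}" using large by auto
  moreover have "\<exists>C. C \<in> \<C> \<and> x \<in> C" if "x \<in> nodes - S"
    using part that unfolding partition_on_def by auto
  then have "x \<in> nodes - S \<Longrightarrow> cls x \<in> \<C> \<and> x \<in> cls x"
    using someI_ex[of "\<lambda>C. C \<in> \<C> \<and> x \<in> C"] unfolding cls_def by auto
  ultimately show "cls x \<in> \<C>" "x \<in> nodes - S \<Longrightarrow> x \<in> cls x"
    using some_in_eq[of \<C>] unfolding cls_def by auto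
qed

text \<open>A port has neighbours only among the cores of its vertex and its mate.  Another port of the vertex
outside \<open>S\<close> is adjacent to all these cores, so at most two members of \<open>\<C>\<close> would be reached.\<close>

lemma port_in_S_all_ports:
  assumes "Port p \<in> S" "q \<in> P" "base q = base p"
  shows "Port q \<in> S"
proof (rule ccontr)
  assume q: "Port q \<notin> S"
  obtain x where x: "x \<in> nodes - S" "adj (Port p) x" "x \<notin> cls (Port q) \<union> cls (Port (mate p))"
    using three[OF assms(1) cls_member cls_member] by blast
  show False
  proof (cases x)
    case (Port p')
    then show False using x cls_self[of "Port (mate p)"] by auto
  next
    case (Core v n)
    then have "adj (Port q) x" using x assms by auto
    then show False
      using x closed[OF cls_member cls_self, of "Port q" x] q assms by auto
  qed (use x in auto)
qed

lemma port_in_S_some_core: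
  assumes "Port p \<in> S"
  shows "\<exists>n < m (base p) + opt (base p). Core (base p) n \<notin> S"
proof (rule ccontr)
  assume no: "\<not> ?thesis"
  obtain x where x: "x \<in> nodes - S" "adj (Port p) x" "x \<notin> cls (Port (mate p)) \<union> cls (Port (mate p))"
    using three[OF assms(1) cls_member cls_member] by blast
  then show False using no cls_self[of "Port (mate p)"] by (cases x) auto
qed

lemma nonport_neighbours_one_class:
  assumes "\<forall>p. s \<noteq> Port p"
  obtains B where "B \<in> \<C>" "\<And>y. y \<in> nodes - S \<Longrightarrow> adj s y \<Longrightarrow> \<forall>p. y \<noteq> Port p \<Longrightarrow> y \<in> B"
proof (cases "\<exists>y \<in> nodes - S. adj s y \<and> (\<forall>p. y \<noteq> Port p)")
  case True
  then obtain y where y: "y \<in> nodes - S" "adj s y" "\<forall>p. y \<noteq> Port p" by blast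
  show ?thesis
  proof (rule that[of "cls y"])
    fix z assume z: "z \<in> nodes - S" "adj s z" "\<forall>p. z \<noteq> Port p"
    then show "z \<in> cls y"
      using nonport_neighbours_adj[OF y(2) z(2) assms y(3) z(3)] cls_self[OF y(1)]
        closed[OF cls_member cls_self[OF y(1)] z(1)] by auto
  qed (rule cls_member)
next
  case False
  then show ?thesis using that[OF cls_member] by blast
qed

text \<open>A core node outside \<open>S\<close> puts all remaining ports of the vertex in one member of \<open>\<C>\<close>, and the
neighbours of a core node that are no ports contribute only one more.\<close>

lemma core_in_S_all_cores:
  assumes "Core v n \<in> S" "n' < m v + opt v"
  shows "Core v n' \<in> S"
proof (rule ccontr)
  assume n': "Core v n' \<notin> S"
  have v: "v \<in> V" using assms S_nodes by auto
  then have n'n: "Core v n' \<in> nodes - S" using n' assms by auto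
  obtain B where B: "B \<in> \<C>" "\<And>y. y \<in> nodes - S \<Longrightarrow> adj (Core v n) y \<Longrightarrow> \<forall>p. y \<noteq> Port p \<Longrightarrow> y \<in> B"
    using nonport_neighbours_one_class[of "Core v n"] by blast
  obtain x where x: "x \<in> nodes - S" "adj (Core v n) x" "x \<notin> cls (Core v n') \<union> B"
    using three[OF assms(1) cls_member B(1)] by blast
  then obtain p where p: "x = Port p" using B(2) by blast
  then have "adj (Core v n') x" using x by auto
  then show False using closed[OF cls_member cls_self[OF n'n] x(1)] x(3) by auto
qed

text \<open>By the preceding lemmas \<open>S\<close> consists of all cores of the vertices in \<open>Sv\<close> and all ports of the vertices
in \<open>Tv\<close>, up to the node \<open>Extra\<close>: it is a pair of disjoint vertex sets as in Lovasz's
theorem on parity factors.\<close>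

definition Sv :: "'b set" where "Sv = {v \<in> V. \<forall>n < m v + opt v. Core v n \<in> S}"
definition Tv :: "'b set" where "Tv = {v \<in> V. \<exists>p\<in>P. base p = v \<and> Port p \<in> S}"

lemma Port_in_S: "p \<in> P \<Longrightarrow> Port p \<in> S \<longleftrightarrow> base p \<in> Tv"
  using port_in_S_all_ports at_V unfolding Tv_def by auto

lemma Core_in_S: "v \<in> V \<Longrightarrow> n < m v + opt v \<Longrightarrow> Core v n \<in> S \<longleftrightarrow> v \<in> Sv"
  using core_in_S_all_cores unfolding Sv_def by auto

lemma Sv_Tv: "v \<in> Sv \<Longrightarrow> v \<notin> Tv" "Sv \<subseteq> V" "Tv \<subseteq> V"
  using port_in_S_some_core unfolding Sv_def Tv_def by auto

text \<open>A discharging argument.  The cores of a vertex in \<open>Sv\<close> pay \<open>1 - r\<close> to each of its ports, and the ports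
of a vertex in \<open>Tv\<close> pay \<open>1\<close> to each of its mandatory cores and \<open>r\<close> along each edge to the opposite port.
The choice of \<open>f\<close> makes \<open>card S\<close> large enough to cover this, while every member of \<open>\<C>\<close> containing no
free node receives at least \<open>1\<close>.\<close>

fun wt :: "('a, 'b) node \<Rightarrow> real" where
  "wt (Port p) = (if base p \<in> Sv then 1 - r else 0) + (if base (mate p) \<in> Tv then r else 0)"
| "wt (Core v n) = (if v \<in> Tv \<and> n < m v then 1 else 0)"
| "wt Extra = 0"

lemma wt_nonneg: "0 \<le> wt x"
  using r01 by (cases x) auto

lemma card_S_ge: "(1 - r) * (\<Sum>v\<in>Sv. real (d v)) + r * (\<Sum>v\<in>Tv. real (d v)) + (\<Sum>v\<in>Tv. real (m v)) \<le> card S"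
proof -
  have fin: "finite Sv" "finite Tv" using Sv_Tv finite_V by (auto intro: finite_subset)
  let ?K = "\<Union>v\<in>Sv. cores v" and ?T = "Port ` {p \<in> P. base p \<in> Tv} :: ('a, 'b) node set"
  have "card (?K \<union> ?T) \<le> card S"
  proof (rule card_mono)
    show "finite S" using S_nodes finite_nodes finite_subset by blast
    show "?K \<union> ?T \<subseteq> S" using Port_in_S unfolding Sv_def cores_def by auto
  qed
  moreover have "card (?K \<union> ?T) = card ?K + card ?T"
    using fin finite_P by (intro card_Un_disjoint) (auto simp: cores_def)
  moreover have "card ?K = (\<Sum>v\<in>Sv. card (cores v))"
    using fin by (intro card_UN_disjoint) (auto simp: cores_def)
  moreover have "card (cores v) = m v + opt v" for v
    unfolding cores_def by (subst card_image) (auto simp: inj_on_def)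
  moreover have "card ?T = (\<Sum>v\<in>Tv. d v)"
    using card_ports_at Sv_Tv(3) by (subst card_image) (auto simp: inj_on_def)
  ultimately have "(\<Sum>v\<in>Sv. real (m v + opt v)) + (\<Sum>v\<in>Tv. real (d v)) \<le> card S"
    by (simp flip: of_nat_sum of_nat_add)
  moreover have "(1 - r) * (\<Sum>v\<in>Sv. real (d v)) \<le> (\<Sum>v\<in>Sv. real (m v + opt v))"
    unfolding sum_distrib_left
  proof (rule sum_mono)
    fix v assume "v \<in> Sv"
    then have "v \<in> V" using Sv_Tv by auto
    then show "(1 - r) * real (d v) \<le> real (m v + opt v)"
      using f_lower[of v] f_le[of v] unfolding m_def opt_def d_def
      by (auto simp: algebra_simps of_nat_diff split: if_splits)
  qed
  moreover have "r * (\<Sum>v\<in>Tv. real (d v)) + (\<Sum>v\<in>Tv. real (m v)) \<le> (\<Sum>v\<in>Tv. real (d v))"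
    unfolding sum_distrib_left sum.distrib[symmetric]
  proof (rule sum_mono)
    fix v assume "v \<in> Tv"
    then have "v \<in> V" using Sv_Tv by auto
    then show "r * real (d v) + real (m v) \<le> real (d v)"
      using f_ge[of v] f_le[of v] unfolding m_def d_def by (auto simp: of_nat_diff)
  qed
  ultimately show ?thesis by linarith
qed

lemma sum_wt_nodes:
  "sum wt nodes = (1 - r) * (\<Sum>v\<in>Sv. real (d v)) + r * (\<Sum>v\<in>Tv. real (d v)) + (\<Sum>v\<in>Tv. real (m v))"
proof -
  have "sum wt nodes = sum wt proper_nodes"
    unfolding nodes_def using finite_proper
    by (intro sum.mono_neutral_right) auto
  also have "\<dots> = sum wt (Port ` P) + sum wt (\<Union>v\<in>V. cores v)"
    unfolding proper_nodes_def using finite_P finite_V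
    by (intro sum.union_disjoint) (auto simp: cores_def)
  also have "sum wt (Port ` P) = (\<Sum>p\<in>P. (if base p \<in> Sv then 1 - r else 0)) + (\<Sum>p\<in>P. (if base (mate p) \<in> Tv then r else 0))"
    by (subst sum.reindex) (auto simp: inj_on_def sum.distrib)
  also have "(\<Sum>p\<in>P. (if base p \<in> Sv then 1 - r else 0)) = (1 - r) * (\<Sum>v\<in>Sv. real (d v))"
    using finite_P card_ports_at[OF Sv_Tv(2)]
    by (simp add: sum.If_cases Int_def flip: of_nat_sum)
  also have "(\<Sum>p\<in>P. (if base (mate p) \<in> Tv then r else 0)) = (\<Sum>p\<in>P. (if base p \<in> Tv then r else 0))"
    by (rule sum.reindex_bij_witness[of _ mate mate]) (auto simp: mate)
  also have "\<dots> = r * (\<Sum>v\<in>Tv. real (d v))"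
    using finite_P card_ports_at[OF Sv_Tv(3)]
    by (simp add: sum.If_cases Int_def flip: of_nat_sum)
  also have "sum wt (\<Union>v\<in>V. cores v) = (\<Sum>v\<in>V. sum wt (cores v))"
    using finite_V by (intro sum.UNION_disjoint) (auto simp: cores_def)
  also have "\<dots> = (\<Sum>v\<in>V. if v \<in> Tv then real (m v) else 0)"
  proof (rule sum.cong[OF refl])
    fix v
    have "sum wt (cores v) = (\<Sum>n<m v + opt v. if v \<in> Tv \<and> n < m v then 1 else 0)"
      unfolding cores_def by (subst sum.reindex) (auto simp: inj_on_def)
    also have "{..<m v + opt v} \<inter> {n. n < m v} = {..<m v}" by auto
    then have "(\<Sum>n<m v + opt v. if v \<in> Tv \<and> n < m v then 1 else 0) = (if v \<in> Tv then real (m v) else 0)"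
      by (simp add: sum.If_cases)
    finally show "sum wt (cores v) = (if v \<in> Tv then real (m v) else 0)" .
  qed
  also have "(\<Sum>v\<in>V. if v \<in> Tv then real (m v) else 0) = (\<Sum>v\<in>Tv. real (m v))"
    using finite_V Sv_Tv(3) by (simp add: sum.If_cases Int_absorb1)
  finally show ?thesis by simp
qed

text \<open>The gadget of a vertex outside \<open>Sv\<close> and \<open>Tv\<close> avoids \<open>S\<close> and is connected, hence lies within one member
of \<open>\<C>\<close>.  If it contains no free node, its vertex is in \<open>U\<close>.\<close>

lemma untouched_gadget:
  assumes v: "v \<in> V" "v \<notin> Sv" "v \<notin> Tv" and C: "C \<in> \<C>" "\<And>x. x \<in> C \<Longrightarrow> \<not> free x"
    and x: "x \<in> C" "x \<in> cores v \<or> x \<in> Port ` {p \<in> P. base p = v}"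
  shows "v \<in> U" "cores v \<subseteq> C" "Port ` {p \<in> P. base p = v} \<subseteq> C"
proof -
  have out: "Core v n \<in> nodes - S" if "n < m v + opt v" for n
    using that v Core_in_S by auto
  have pout: "Port p \<in> nodes - S" if "p \<in> P" "base p = v" for p
    using that v Port_in_S by auto
  have opt_pos: "0 < m v + opt v" unfolding opt_def by auto
  have "cores v \<subseteq> C \<and> Port ` {p \<in> P. base p = v} \<subseteq> C"
  proof (cases "\<exists>q\<in>P. base q = v")
    case True
    then obtain q where q: "q \<in> P" "base q = v" by blast
    have one_port: "cores v \<subseteq> C" if "Port p \<in> C" "p \<in> P" "base p = v" for p
      using closed[OF C(1) that(1)] out that unfolding cores_def by auto
    have one_core: "Port ` {p \<in> P. base p = v} \<subseteq> C" if "Core v n \<in> C" for n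
      using closed[OF C(1) that] pout by auto
    have zero: "Core v 0 \<in> cores v" using opt_pos unfolding cores_def by auto
    show ?thesis
    proof (cases x)
      case (Port p)
      then have "cores v \<subseteq> C" using x one_port by (auto simp: cores_def)
      then show ?thesis using one_core zero by blast
    next
      case (Core w n)
      then have "Port ` {p \<in> P. base p = v} \<subseteq> C" using x one_core by (auto simp: cores_def)
      then show ?thesis using one_port q by blast
    qed (use x in \<open>auto simp: cores_def\<close>)
  next
    case False
    then have "{p \<in> P. base p = v} = {}" by auto
    then have "d v = 0" unfolding d_def by (metis card.empty)
    then have m0: "m v = 0" unfolding m_def by simp
    obtain n where n: "x = Core v n" "n < opt v" using x False m0 unfolding cores_def by auto
    have "Core v k \<in> C" if "k < opt v" for k
    proof (cases "k = n")
      case False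
      then have "adj x (Core v k)" using n that m0 unfolding opt_def by (auto split: if_splits)
      then show ?thesis using closed[OF C(1) x(1)] out that m0 by auto
    qed (use n x in auto)
    then show ?thesis using False m0 unfolding cores_def by auto
  qed
  moreover have "v \<in> U"
  proof (rule ccontr)
    assume "v \<notin> U"
    then have "Core v (m v) \<in> cores v" "free (Core v (m v))" unfolding cores_def opt_def by auto
    then show False using calculation C(2) by blast
  qed
  ultimately show "v \<in> U" "cores v \<subseteq> C" "Port ` {p \<in> P. base p = v} \<subseteq> C" by auto
qed

text \<open>Without free nodes only vertices of \<open>U\<close> contribute, and for these \<open>m v\<close> is even.  Exchanging the core
nodes with numbers \<open>2i\<close> and \<open>2i + 1\<close> is therefore an involution that respects both complete gadgets and
pairs of optional nodes.\<close>

lemma even_cores_of_member: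
  assumes C: "C \<in> \<C>" "\<And>x. x \<in> C \<Longrightarrow> \<not> free x"
    and mandatory: "\<And>v n. Core v n \<in> C \<Longrightarrow> v \<in> Tv \<Longrightarrow> m v \<le> n"
  shows "even (card {x \<in> C. \<exists>v n. x = Core v n})"
proof -
  define g where "g x = (case x of Core v n \<Rightarrow> Core v (if even n then Suc n else n - 1) | _ \<Rightarrow> x)"
    for x :: "('a, 'b) node"
  show ?thesis
  proof (rule even_card_of_involution[where g = g])
    show "finite {x \<in> C. \<exists>v n. x = Core v n}" using member_finite[OF C(1)] by auto
    fix x assume "x \<in> {x \<in> C. \<exists>v n. x = Core v n}"
    then obtain v n where x: "x = Core v n" "Core v n \<in> C" by auto
    have vn: "v \<in> V" "n < m v + opt v" "Core v n \<notin> S"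
      using member_subset[OF C(1)] x by auto
    then have notS: "v \<notin> Sv" using Core_in_S by auto
    let ?k = "if even n then Suc n else n - 1"
    have "Core v ?k \<in> C"
    proof (cases "v \<in> Tv")
      case False
      have "v \<in> U" "cores v \<subseteq> C"
        using untouched_gadget[OF vn(1) notS False C x(2)] vn unfolding cores_def by auto
      moreover have "?k < m v + opt v"
        using even_m[OF \<open>v \<in> U\<close>] vn(2) \<open>v \<in> U\<close> unfolding opt_def
        by (cases "n = Suc (m v)") (auto elim: evenE oddE)
      ultimately show ?thesis unfolding cores_def by auto
    next
      case True
      then have "m v \<le> n" using mandatory x by blast
      have U: "v \<in> U"
      proof (rule ccontr)
        assume "v \<notin> U"
        then have "n = m v" using \<open>m v \<le> n\<close> vn unfolding opt_def by auto
        then show False using C(2)[OF x(2)] \<open>v \<notin> U\<close> by auto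
      qed
      then have "n = m v \<or> n = Suc (m v)" using \<open>m v \<le> n\<close> vn unfolding opt_def by auto
      then have "adj (Core v n) (Core v ?k)" "?k < m v + opt v"
        using even_m[OF U] U unfolding opt_def by auto
      then show ?thesis using closed[OF C(1) x(2)] vn notS Core_in_S by auto
    qed
    moreover have "g (g x) = x" "g x \<noteq> x" "g x = Core v ?k"
      unfolding x g_def by (auto elim: oddE)
    ultimately show "g x \<in> {x \<in> C. \<exists>v n. x = Core v n} \<and> g (g x) = x \<and> g x \<noteq> x" by auto
  qed
qed

text \<open>Suppose the weight is below \<open>1\<close>.  Pairing mates inside \<open>C\<close> and using that the number of cores is even,
the number of ports in \<open>C\<close> whose mate lies at a vertex of \<open>Tv\<close> is odd, in particular positive, and each of these
ports receives \<open>r\<close>.  A port of a vertex in \<open>Sv\<close> adds \<open>1 - r\<close>, which is enough.  Otherwise all ports in \<open>C\<close>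
are those of a set \<open>A \<subseteq> U\<close> of vertices, and the ports just counted are exactly the half-edges
leaving \<open>A\<close>, so that assumption \<open>odd_cut\<close> applies.\<close>

lemma wt_member_ge_1:
  assumes C: "C \<in> \<C>" "\<And>x. x \<in> C \<Longrightarrow> \<not> free x"
  shows "1 \<le> sum wt C"
proof (rule ccontr)
  assume less: "\<not> 1 \<le> sum wt C"
  let ?port = "Port :: 'a \<Rightarrow> ('a, 'b) node"
  note finC = member_finite[OF C(1)]
  have le: "sum wt X \<le> sum wt C" if "X \<subseteq> C" for X
    using that finC wt_nonneg by (intro sum_mono2) auto
  have single: "wt x < 1" if "x \<in> C" for x using le[of "{x}"] that less by auto
  have mandatory: "m v \<le> n" if "Core v n \<in> C" "v \<in> Tv" for v n
    using single[OF that(1)] that(2) by (auto split: if_splits)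
  have no_ST: "base (mate p) \<notin> Tv" if "Port p \<in> C" "base p \<in> Sv" for p
    using single[OF that(1)] that(2) by (auto split: if_splits)
  define Q where "Q = {p \<in> P. Port p \<in> C}"
  define Q0 where "Q0 = {p \<in> Q. base (mate p) \<notin> Tv}"
  define Q1 where "Q1 = {p \<in> Q. base (mate p) \<in> Tv}"
  have finQ: "finite Q" unfolding Q_def using finite_P by auto
  have mateC: "Port (mate p) \<in> C" if "p \<in> Q" "base (mate p) \<notin> Tv" for p
    using closed[OF C(1), of "Port p" "Port (mate p)"] that mate Port_in_S unfolding Q_def by auto
  have notT: "base p \<notin> Tv" if "p \<in> Q" for p
    using that Port_in_S member_subset[OF C(1)] unfolding Q_def by auto
  have "even (card Q0)"
  proof (rule even_card_of_involution[where g = mate])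
    show "finite Q0" unfolding Q0_def using finQ by auto
    show "mate p \<in> Q0 \<and> mate (mate p) = p \<and> mate p \<noteq> p" if "p \<in> Q0" for p
      using that mate mateC notT unfolding Q0_def Q_def by auto
  qed
  moreover have "card Q = card Q0 + card Q1"
    using finQ by (subst card_Un_disjoint[symmetric]) (auto simp: Q0_def Q1_def intro: arg_cong[of _ _ card])
  moreover have "card C = card {x \<in> C. \<exists>v n. x = Core v n} + card (?port ` Q)"
  proof -
    have "C = {x \<in> C. \<exists>v n. x = Core v n} \<union> Port ` Q"
    proof (intro equalityI subsetI)
      fix x assume x: "x \<in> C"
      then show "x \<in> {x \<in> C. \<exists>v n. x = Core v n} \<union> Port ` Q"
        using C(2)[OF x] member_subset[OF C(1)] unfolding Q_def by (cases x) auto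
    qed (auto simp: Q_def)
    then have "card C = card ({x \<in> C. \<exists>v n. x = Core v n} \<union> Port ` Q)" by simp
    also have "\<dots> = card {x \<in> C. \<exists>v n. x = Core v n} + card (?port ` Q)"
      using finC finQ by (intro card_Un_disjoint) auto
    finally show ?thesis .
  qed
  moreover have "card (?port ` Q) = card Q" by (rule card_image) (auto simp: inj_on_def)
  ultimately have odd: "odd (card Q1)"
    using odd_member[OF C(1)] even_cores_of_member[OF C mandatory] by auto
  have wtQ1: "r * card Q1 \<le> sum wt (Port ` Q1)"
  proof -
    have "sum wt (Port ` Q1) = (\<Sum>p\<in>Q1. wt (Port p))"
      by (subst sum.reindex) (auto simp: inj_on_def)
    also have "\<dots> \<ge> (\<Sum>p\<in>Q1. r)"
      by (rule sum_mono) (use r01 in \<open>auto simp: Q1_def\<close>)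
    finally show ?thesis by (simp add: mult.commute)
  qed
  show False
  proof (cases "\<exists>p\<in>Q. base p \<in> Sv")
    case True
    then obtain p where p: "p \<in> Q" "base p \<in> Sv" by blast
    obtain p' where p': "p' \<in> Q1" using odd by (metis card.empty ex_in_conv odd_card_imp_not_empty)
    have "p \<noteq> p'" using no_ST p p' unfolding Q1_def Q_def by auto
    have "sum wt {Port p, Port p'} \<le> sum wt C" using p p' unfolding Q1_def Q_def by (intro le) auto
    moreover have "wt (Port p) \<ge> 1 - r" "wt (Port p') \<ge> r"
      using p p' r01 unfolding Q1_def by auto
    ultimately show False using less \<open>p \<noteq> p'\<close> by auto
  next
    case False
    define A where "A = {v \<in> V. v \<notin> Sv \<and> v \<notin> Tv \<and> (\<exists>p\<in>Q. base p = v)}"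
    have full: "v \<in> U" "Port ` {p \<in> P. base p = v} \<subseteq> C" if vA: "v \<in> A" for v
    proof -
      obtain p where "p \<in> Q" "base p = v" using vA unfolding A_def by blast
      then show "v \<in> U" "Port ` {p \<in> P. base p = v} \<subseteq> C"
        using untouched_gadget[OF _ _ _ C, of v "Port p"] vA unfolding A_def Q_def by auto
    qed
    have QA: "base p \<in> A" if "p \<in> Q" for p
      using that False notT at_V unfolding A_def Q_def by auto
    have "Q1 = {p \<in> P. base p \<in> A \<and> base (mate p) \<notin> A}"
    proof (intro equalityI subsetI)
      fix p assume "p \<in> Q1"
      then show "p \<in> {p \<in> P. base p \<in> A \<and> base (mate p) \<notin> A}"
        using QA unfolding Q1_def Q_def A_def by auto
    next
      fix p assume p: "p \<in> {p \<in> P. base p \<in> A \<and> base (mate p) \<notin> A}"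
      then have "p \<in> Q" using full(2)[of "base p"] unfolding Q_def by auto
      moreover have "base (mate p) \<in> Tv"
      proof (rule ccontr)
        assume "base (mate p) \<notin> Tv"
        then have "mate p \<in> Q" using mateC \<open>p \<in> Q\<close> mate p unfolding Q_def by auto
        then show False using QA p by auto
      qed
      ultimately show "p \<in> Q1" unfolding Q1_def by auto
    qed
    then have "1 \<le> r * real (card Q1)" using odd_cut[of A] odd full(1) by auto
    moreover have "sum wt (Port ` Q1) \<le> sum wt C" by (rule le) (auto simp: Q1_def Q_def)
    ultimately show False using wtQ1 less by linarith
  qed
qed

text \<open>Since the free nodes form a clique, at most one member of \<open>\<C>\<close> contains any; the others number at least
\<open>card S + 1\<close> and together receive at most \<open>card S\<close>.\<close>

lemma no_large_minimal_barrier: False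
proof -
  define Fr where "Fr = {C \<in> \<C>. \<exists>x\<in>C. free x}"
  have "C = D" if CD: "C \<in> Fr" "D \<in> Fr" for C D
  proof -
    obtain x y where xy: "x \<in> C" "y \<in> D" "free x" "free y" "C \<in> \<C>" "D \<in> \<C>" using CD unfolding Fr_def by auto
    have "y \<in> C" using free_adj[OF xy(3,4)] closed[OF xy(5,1)] xy member_subset by blast
    then show "C = D" using part xy unfolding partition_on_def disjoint_def by auto
  qed
  then have "card Fr \<le> 1"
    by (metis card_le_Suc0_iff_eq card.infinite One_nat_def le_SucI zero_le)
  moreover have "card \<C> = card Fr + card (\<C> - Fr)"
    using finite_members by (subst card_Un_disjoint[symmetric]) (auto simp: Fr_def intro: arg_cong[of _ _ card])
  ultimately have "card S + 1 \<le> card (\<C> - Fr)" using large by linarith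
  then have "real (card S) + 1 \<le> real (card (\<C> - Fr))" by linarith
  also have "\<dots> = (\<Sum>C\<in>\<C> - Fr. 1)" by simp
  also have "\<dots> \<le> (\<Sum>C\<in>\<C> - Fr. sum wt C)"
    using wt_member_ge_1 unfolding Fr_def by (intro sum_mono) auto
  also have "\<dots> \<le> (\<Sum>C\<in>\<C>. sum wt C)"
    using finite_members wt_nonneg by (intro sum_mono2) (auto intro: sum_nonneg)
  also have "\<dots> = sum wt (\<Union>\<C>)"
    using part member_finite unfolding partition_on_def disjoint_def
    by (subst sum.Union_disjoint) auto
  also have "\<dots> \<le> sum wt nodes"
    using part finite_nodes wt_nonneg unfolding partition_on_def by (intro sum_mono2) auto
  also have "\<dots> \<le> card S" using sum_wt_nodes card_S_ge by simp
  finally show False by simp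
qed

end

context degree_gadget
begin

lemma ex_perfect_matching: "\<exists>M. matching_on nodes adj M \<and> missed nodes M = {}"
proof (rule ccontr)
  assume "\<not> ?thesis"
  then obtain S \<C> where "odd_barrier nodes adj S \<C>" "card S + 2 \<le> card \<C>"
    and "\<And>s A B. s \<in> S \<Longrightarrow> A \<in> \<C> \<Longrightarrow> B \<in> \<C> \<Longrightarrow> \<exists>x \<in> nodes - S. adj s x \<and> x \<notin> A \<union> B"
    using minimal_barrier[of nodes adj, OF finite_nodes adj_sym even_nodes] by metis
  then interpret gadget_barrier P mate base V U f r S \<C>
    by unfold_locales auto
  show False by (rule no_large_minimal_barrier)
qed

text \<open>The ports matched to their mates are selected.  The number of cores of \<open>v\<close> matched to ports is the
number of ports of \<open>v\<close> that are not selected.\<close>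

lemma ex_port_selection:
  "\<exists>F \<subseteq> P. (\<forall>p\<in>F. mate p \<in> F) \<and>
     (\<forall>v\<in>V. card {p \<in> F. base p = v} = f v \<or> card {p \<in> F. base p = v} + opt v = f v)"
proof -
  obtain M where M: "matching_on nodes adj M" "missed nodes M = {}" using ex_perfect_matching by blast
  have Mx: "M x \<in> nodes" "M (M x) = x" "adj x (M x)" if "x \<in> nodes" for x
    using matching_onD[OF M(1) that] M(2) that unfolding missed_def by auto
  define F where "F = {p \<in> P. M (Port p) = Port (mate p)}"
  have "mate p \<in> F" if "p \<in> F" for p
    using that Mx[of "Port p"] mate unfolding F_def by auto
  moreover have "card {p \<in> F. base p = v} = f v \<or> card {p \<in> F. base p = v} + opt v = f v" if v: "v \<in> V" for v
  proof -
    let ?core = "Core :: 'v \<Rightarrow> nat \<Rightarrow> ('p, 'v) node"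
    define B where "B = {p \<in> P. base p = v \<and> p \<notin> F}"
    define K where "K = {n. n < m v + opt v \<and> (\<exists>p. M (Core v n) = Port p)}"
    have "M ` Port ` B = ?core v ` K"
    proof (intro equalityI subsetI)
      fix x assume "x \<in> M ` Port ` B"
      then obtain p where p: "p \<in> B" "x = M (Port p)" by auto
      then have x: "x \<in> nodes" "M x = Port p" "adj (Port p) x" using Mx[of "Port p"] unfolding B_def by auto
      have "x \<noteq> Port (mate p)" "base p = v" using p unfolding B_def F_def by auto
      with x show "x \<in> ?core v ` K"
        by (cases x) (auto simp: K_def)
    next
      fix x assume "x \<in> ?core v ` K"
      then obtain n p where n: "x = Core v n" "n < m v + opt v" "M (Core v n) = Port p" unfolding K_def by auto
      then have "p \<in> P" "M (Port p) = Core v n" "base p = v" using Mx[of "Core v n"] v by auto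
      then have "p \<in> B" unfolding B_def F_def by auto
      then show "x \<in> M ` Port ` B" using \<open>M (Port p) = Core v n\<close> n(1) by force
    qed
    moreover have "card (M ` Port ` B) = card B"
      unfolding image_image
    proof (intro card_image inj_onI)
      fix x y assume "x \<in> B" "y \<in> B" "M (Port x) = M (Port y)"
      then show "x = y" using matching_inj[OF M(1), of "Port x" "Port y"] by (auto simp: B_def)
    qed
    moreover have "card (?core v ` K) = card K" by (rule card_image) (auto simp: inj_on_def)
    ultimately have BK: "card B = card K" by simp
    have card_d: "card {p \<in> F. base p = v} + card B = d v"
      unfolding d_def using finite_P
      by (subst card_Un_disjoint[symmetric]) (auto simp: F_def B_def intro: arg_cong[of _ _ card])
    have low: "{..<m v} \<subseteq> K"
    proof
      fix n assume "n \<in> {..<m v}"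
      then show "n \<in> K" using Mx[of "Core v n"] v unfolding K_def by (cases "M (Core v n)") auto
    qed
    have up: "K \<subseteq> {..<m v + opt v}" unfolding K_def by auto
    have "K = {..<m v} \<or> K = {..<m v + opt v}"
    proof (cases "v \<in> U")
      case True
      then have opt2: "opt v = 2" unfolding opt_def by simp
      have "m v \<in> K \<longleftrightarrow> Suc (m v) \<in> K"
      proof
        assume k: "m v \<in> K"
        show "Suc (m v) \<in> K"
          using k Mx[of "Core v (Suc (m v))"] v True opt2 unfolding K_def
          by (cases "M (Core v (Suc (m v)))") auto
      next
        assume k: "Suc (m v) \<in> K"
        show "m v \<in> K"
          using k Mx[of "Core v (m v)"] v True opt2 unfolding K_def
          by (cases "M (Core v (m v))") auto
      qed
      moreover have "{..<m v + opt v} = {..<m v} \<union> {m v, Suc (m v)}" using opt2 by auto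
      ultimately show ?thesis using low up by auto
    next
      case False
      then have "{..<m v + opt v} = {..<m v} \<union> {m v}" unfolding opt_def by auto
      then show ?thesis using low up by auto
    qed
    then have "card K = m v \<or> card K = m v + opt v" by auto
    moreover have "f v \<le> d v" using f_le[OF v] unfolding d_def by simp
    ultimately show ?thesis using card_d BK unfolding m_def by auto
  qed
  ultimately show ?thesis by (intro exI[of _ F]) (auto simp: F_def)
qed

end

section \<open>Splitting the edge set of a multigraph\<close>

abbreviation edge_degree :: "('v, 'e) multigraph \<Rightarrow> 'e set \<Rightarrow> 'v \<Rightarrow> nat" where
  "edge_degree G X v \<equiv> degree (G\<lparr>edges := X\<rparr>) v"

lemma edge_degree_split:
  assumes "finite X" "F \<subseteq> X"
  shows "edge_degree G X v = edge_degree G F v + edge_degree G (X - F) v"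
proof -
  have "card {e \<in> X. Q e} = card {e \<in> F. Q e} + card {e \<in> X - F. Q e}" for Q
    using assms by (subst card_Un_disjoint[symmetric])
      (auto intro: finite_subset arg_cong[of _ _ card])
  from this[of "\<lambda>e. v \<in> set_uprod (ends G e)"] this[of "\<lambda>e. ends G e = Upair v v"]
  show ?thesis unfolding degree_def by simp
qed

lemma ex_ordered_ends: "\<exists>g. \<forall>e. ends G e = Upair (g e True) (g e False)"
proof -
  have "\<exists>h. ends G e = Upair (h True) (h False)" for e
  proof -
    obtain x y where "ends G e = Upair x y" by (cases "ends G e") auto
    then show ?thesis by (intro exI[of _ "\<lambda>b. if b then x else y"]) auto
  qed
  then show ?thesis by metis
qed

text \<open>The function \<open>g\<close> orders the ends of each edge, and the pair \<open>(e, b)\<close> stands for the half of \<open>e\<close>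
incident with \<open>g e b\<close>.  A loop yields two half-edges at its vertex, in accordance with \<open>degree\<close>.\<close>

lemma card_half_edges_at:
  assumes "finite X" "\<And>e. e \<in> X \<Longrightarrow> ends G e = Upair (g e True) (g e False)"
  shows "card {p \<in> X \<times> UNIV. g (fst p) (snd p) = v} = edge_degree G X v"
proof -
  let ?T = "{e \<in> X. g e True = v}" and ?F = "{e \<in> X. g e False = v}"
  have "{p \<in> X \<times> UNIV. g (fst p) (snd p) = v} = ?T \<times> {True} \<union> ?F \<times> {False}"
    by (auto, (metis (full_types))+)
  also have "card \<dots> = card (?T \<times> {True}) + card (?F \<times> {False})"
    using assms(1) by (intro card_Un_disjoint) auto
  also have "\<dots> = card ?T + card ?F" by (simp add: card_cartesian_product)
  also have "\<dots> = card (?T \<union> ?F) + card (?T \<inter> ?F)"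
    using assms(1) by (intro card_Un_Int) auto
  also have "?T \<union> ?F = {e \<in> X. v \<in> set_uprod (ends G e)}" using assms(2) by auto
  also have "?T \<inter> ?F = {e \<in> X. ends G e = Upair v v}" using assms(2) by auto
  finally show ?thesis unfolding degree_def by simp
qed

lemma card_half_edges_leaving:
  assumes "finite X" "\<And>e. e \<in> X \<Longrightarrow> ends G e = Upair (g e True) (g e False)"
  shows "card {p \<in> X \<times> UNIV. g (fst p) (snd p) \<in> A \<and> g (fst p) (\<not> snd p) \<notin> A}
    = card (cut_edges (G\<lparr>edges := X\<rparr>) A)"
proof (rule bij_betw_same_card[of fst], rule bij_betw_imageI)
  let ?L = "{p \<in> X \<times> UNIV. g (fst p) (snd p) \<in> A \<and> g (fst p) (\<not> snd p) \<notin> A}"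
  show "inj_on fst ?L"
    by (intro inj_onI prod_eqI) (auto, (metis (full_types))+)
  show "fst ` ?L = cut_edges (G\<lparr>edges := X\<rparr>) A"
  proof (intro equalityI subsetI)
    fix e assume "e \<in> fst ` ?L"
    then obtain b where b: "e \<in> X" "g e b \<in> A" "g e (\<not> b) \<notin> A" by auto
    then have "ends G e = Upair (g e b) (g e (\<not> b))" using assms(2) by (cases b) (auto simp: Upair_inject)
    then show "e \<in> cut_edges (G\<lparr>edges := X\<rparr>) A" using b unfolding cut_edges_def by auto
  next
    fix e assume "e \<in> cut_edges (G\<lparr>edges := X\<rparr>) A"
    then obtain x y where xy: "e \<in> X" "ends G e = Upair x y" "x \<in> A" "y \<notin> A"
      unfolding cut_edges_def by (simp del: Upair_inject) blast
    then have "Upair x y = Upair (g e True) (g e False)" using assms(2) by metis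
    then obtain b where "g e b = x" "g e (\<not> b) = y"
      by (metis (full_types) Upair_inject)
    then have "(e, b) \<in> ?L" using xy by auto
    then show "e \<in> fst ` ?L" by force
  qed
qed

lemma even_cut_if_even_degrees:
  assumes "finite_multigraph G" "A \<subseteq> verts G" "\<And>v. v \<in> A \<Longrightarrow> even (degree G v)"
  shows "even (card (cut_edges G A))"
proof -
  interpret finite_multigraph G by fact
  obtain g where g: "\<And>e. ends G e = Upair (g e True) (g e False)"
    using ex_ordered_ends[of G] by blast
  have fin: "finite A" using assms(2) finite_verts finite_subset by blast
  let ?P = "edges G \<times> (UNIV :: bool set)"
  let ?b = "\<lambda>p. g (fst p) (snd p)" and ?c = "\<lambda>p. g (fst p) (\<not> snd p)"
  have P: "finite ?P" using finite_edges by auto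
  have "card {p \<in> ?P. ?b p \<in> A} = (\<Sum>v\<in>A. card {p \<in> ?P. ?b p = v})"
    using fin P by (subst card_UN_disjoint[symmetric]) (auto intro: arg_cong[of _ _ card])
  also have "\<dots> = (\<Sum>v\<in>A. degree G v)"
    using card_half_edges_at[of "edges G" G g, OF finite_edges g] by (intro sum.cong) auto
  finally have "even (card {p \<in> ?P. ?b p \<in> A})" using assms(3) by (simp add: dvd_sum)
  moreover have "card {p \<in> ?P. ?b p \<in> A} =
      card {p \<in> ?P. ?b p \<in> A \<and> ?c p \<in> A} + card {p \<in> ?P. ?b p \<in> A \<and> ?c p \<notin> A}"
    using P by (subst card_Un_disjoint[symmetric]) (auto intro: arg_cong[of _ _ card])
  moreover have "even (card {p \<in> ?P. ?b p \<in> A \<and> ?c p \<in> A})"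
    using P by (intro even_card_of_involution[where g = "\<lambda>p. (fst p, \<not> snd p)"]) (auto simp: prod_eq_iff)
  moreover have "card {p \<in> ?P. ?b p \<in> A \<and> ?c p \<notin> A} = card (cut_edges G A)"
    using card_half_edges_leaving[of "edges G" G g A, OF finite_edges g] by simp
  ultimately show ?thesis by simp
qed

text \<open>The upper degree \<open>f v\<close> prescribed to the gadget is \<open>r * degree G v\<close> rounded up, on \<open>U\<close> rounded up to
the parity of the degree.  The two admissible degrees then lie on the two sides of \<open>r * degree G v\<close>,
at distance at most \<open>1\<close> or \<open>2\<close>.\<close>

lemma parity_respecting_splitting:
  assumes "finite_multigraph G" and U: "U \<subseteq> verts G" and r: "0 \<le> r" "r \<le> 1"
    and cut: "\<And>A. A \<subseteq> U \<Longrightarrow> odd (card (cut_edges G A)) \<Longrightarrow> 1 \<le> r * real (card (cut_edges G A))"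
  shows "\<exists>F \<subseteq> edges G. \<forall>v \<in> verts G.
    \<bar>real (edge_degree G F v) - r * real (degree G v)\<bar> \<le> (if v \<in> U then 2 else 1) \<and>
    (v \<in> U \<longrightarrow> (even (edge_degree G F v) \<longleftrightarrow> even (degree G v)))"
proof -
  interpret finite_multigraph G by fact
  obtain g where g: "\<And>e. ends G e = Upair (g e True) (g e False)"
    using ex_ordered_ends[of G] by blast
  define P where "P = edges G \<times> (UNIV :: bool set)"
  define b where "b p = g (fst p) (snd p)" for p
  define mate where "mate p = (fst p, \<not> snd p)" for p :: "'b \<times> bool"
  define c where "c v = nat \<lceil>r * real (degree G v)\<rceil>" for v
  define f where "f v = (if v \<in> U \<and> (even (c v) \<noteq> even (degree G v)) then Suc (c v) else c v)" for v
  have deg: "card {p \<in> P. b p = v} = degree G v" for v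
    using card_half_edges_at[of "edges G" G g, OF finite_edges g] unfolding P_def b_def by simp
  have leave: "card {p \<in> P. b p \<in> A \<and> b (mate p) \<notin> A} = card (cut_edges G A)" for A
    using card_half_edges_leaving[of "edges G" G g A, OF finite_edges g]
    unfolding P_def b_def mate_def by simp
  have c_ge: "r * real (degree G v) \<le> real (c v)" and c_less: "real (c v) < r * real (degree G v) + 1"
    and c_le: "c v \<le> degree G v" for v
  proof -
    have nn: "0 \<le> r * real (degree G v)" using r by simp
    then have c: "real (c v) = real_of_int \<lceil>r * real (degree G v)\<rceil>" unfolding c_def by simp
    show "r * real (degree G v) \<le> real (c v)" "real (c v) < r * real (degree G v) + 1"
      unfolding c by linarith+
    moreover have "r * real (degree G v) \<le> real (degree G v)" using r by (simp add: mult_left_le_one_le)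
    ultimately show "c v \<le> degree G v" by linarith
  qed
  interpret gadget: degree_gadget P mate b "verts G" U f r
  proof
    show "finite P" "finite (verts G)" "U \<subseteq> verts G" "0 \<le> r" "r \<le> 1"
      using finite_edges finite_verts U r unfolding P_def by auto
    show "mate p \<in> P" "mate (mate p) = p" "mate p \<noteq> p" if "p \<in> P" for p
      using that unfolding P_def mate_def by (auto simp: prod_eq_iff)
    show "b p \<in> verts G" if "p \<in> P" for p
    proof -
      have "b p \<in> set_uprod (ends G (fst p))"
        using g[of "fst p"] unfolding b_def by (cases "snd p") auto
      then show ?thesis using that ends_in_verts[of "fst p"] unfolding P_def by auto
    qed
    show "f v \<le> card {p \<in> P. b p = v}" for v
      unfolding deg f_def using c_le[of v] by (cases "c v = degree G v") auto
    show "r * real (card {p \<in> P. b p = v}) \<le> real (f v)" for v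
      unfolding deg f_def using c_ge[of v] by auto
    show "real (f v) - (if v \<in> U then 2 else 1) \<le> r * real (card {p \<in> P. b p = v})" for v
      unfolding deg f_def using c_less[of v] by auto
    show "even (f v) \<longleftrightarrow> even (card {p \<in> P. b p = v})" if "v \<in> U" for v
      unfolding deg f_def using that by auto
    show "1 \<le> r * real (card {p \<in> P. b p \<in> A \<and> b (mate p) \<notin> A})"
      if "A \<subseteq> U" "odd (card {p \<in> P. b p \<in> A \<and> b (mate p) \<notin> A})" for A
      using cut that unfolding leave by blast
  qed
  obtain F' where F': "F' \<subseteq> P" "\<And>p. p \<in> F' \<Longrightarrow> mate p \<in> F'"
    "\<And>v. v \<in> verts G \<Longrightarrow> card {p \<in> F'. b p = v} = f v \<or> card {p \<in> F'. b p = v} + gadget.opt v = f v"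
    using gadget.ex_port_selection by blast
  define F where "F = fst ` F'"
  have F'_eq: "F' = F \<times> UNIV"
  proof (intro equalityI subsetI)
    fix p assume "p \<in> F \<times> (UNIV :: bool set)"
    then obtain p' where "p' \<in> F'" "fst p = fst p'" unfolding F_def by auto
    then have "p' \<in> F'" "p = p' \<or> p = mate p'" unfolding mate_def by (auto simp: prod_eq_iff)
    then show "p \<in> F'" using F'(2) by blast
  qed (auto simp: F_def image_iff, force)
  have FX: "F \<subseteq> edges G" using F'(1) unfolding F_def P_def by auto
  have degF: "card {p \<in> F'. b p = v} = edge_degree G F v" for v
    using card_half_edges_at[of F G g, OF finite_subset[OF FX finite_edges] g] unfolding F'_eq b_def by simp
  have "\<bar>real (edge_degree G F v) - r * real (degree G v)\<bar> \<le> (if v \<in> U then 2 else 1) \<and>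
    (v \<in> U \<longrightarrow> (even (edge_degree G F v) \<longleftrightarrow> even (degree G v)))" if v: "v \<in> verts G" for v
  proof -
    have "edge_degree G F v = f v \<or> edge_degree G F v + gadget.opt v = f v"
      using F'(3)[OF v] degF by simp
    moreover have "v \<in> U \<Longrightarrow> even (edge_degree G F v) \<longleftrightarrow> even (f v)"
    proof -
      assume "v \<in> U"
      then have "f v = edge_degree G F v \<or> f v = edge_degree G F v + 2"
        using calculation unfolding gadget.opt_def by auto
      then show ?thesis by auto
    qed
    moreover have "v \<in> U \<Longrightarrow> even (f v) \<longleftrightarrow> even (degree G v)" unfolding f_def by auto
    moreover have "r * real (degree G v) \<le> real (f v)"
      "real (f v) \<le> r * real (degree G v) + (if v \<in> U then 2 else 1)"
      using c_ge[of v] c_less[of v] unfolding f_def by auto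
    ultimately show ?thesis unfolding gadget.opt_def by (cases "v \<in> U") (auto simp flip: of_nat_add)
  qed
  then show ?thesis using FX by blast
qed

section \<open>Many factors with bounded error\<close>

lemma finite_multigraph_edge_subset:
  assumes "finite_multigraph G" "X \<subseteq> edges G"
  shows "finite_multigraph (G\<lparr>edges := X\<rparr>)"
proof -
  interpret finite_multigraph G by fact
  show ?thesis
    using assms(2) finite_verts finite_edges ends_in_verts finite_subset
    by unfold_locales auto
qed

text \<open>With \<open>U\<close> the set of vertices of \<open>W\<close> whose degree in \<open>X\<close> is even there is no odd cut to consider, so
any \<open>r\<close> is possible.  The error of \<open>X\<close> relative to a target \<open>t\<close> is passed on to both sides in proportion
to their share, plus the error of the splitting itself.\<close>

lemma scaled_splitting:
  fixes t :: "'v \<Rightarrow> real"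
  assumes G: "finite_multigraph G" and X: "X \<subseteq> edges G" and W: "W \<subseteq> verts G"
    and r: "0 \<le> r" "r \<le> 1"
  obtains F where "F \<subseteq> X"
    and "\<And>v. v \<in> verts G \<Longrightarrow> \<bar>real (edge_degree G F v) - r * t v\<bar>
           \<le> (if v \<in> W then 2 else 1) + r * \<bar>real (edge_degree G X v) - t v\<bar>"
    and "\<And>v. v \<in> verts G \<Longrightarrow> \<bar>real (edge_degree G (X - F) v) - (1 - r) * t v\<bar>
           \<le> (if v \<in> W then 2 else 1) + (1 - r) * \<bar>real (edge_degree G X v) - t v\<bar>"
    and "\<And>v. v \<in> W \<Longrightarrow> even (edge_degree G X v) \<Longrightarrow> even (edge_degree G F v)"
proof -
  let ?H = "G\<lparr>edges := X\<rparr>"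
  define U where "U = {v \<in> W. even (edge_degree G X v)}"
  have H: "finite_multigraph ?H" using finite_multigraph_edge_subset G X by blast
  have "even (card (cut_edges ?H A))" if "A \<subseteq> U" for A
    using even_cut_if_even_degrees[OF H, of A] that W unfolding U_def by auto
  then have "\<exists>F \<subseteq> edges ?H. \<forall>v \<in> verts ?H.
      \<bar>real (edge_degree ?H F v) - r * real (degree ?H v)\<bar> \<le> (if v \<in> U then 2 else 1) \<and>
      (v \<in> U \<longrightarrow> (even (edge_degree ?H F v) \<longleftrightarrow> even (degree ?H v)))"
    using W r unfolding U_def by (intro parity_respecting_splitting[OF H]) auto
  then obtain F where F: "F \<subseteq> X"
    "\<And>v. v \<in> verts G \<Longrightarrow> \<bar>real (edge_degree G F v) - r * real (edge_degree G X v)\<bar>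
        \<le> (if v \<in> U then 2 else 1)"
    "\<And>v. v \<in> U \<Longrightarrow> even (edge_degree G F v) \<longleftrightarrow> even (edge_degree G X v)"
    using W unfolding U_def by auto
  have finX: "finite X"
    using X finite_multigraph.finite_edges[OF G] finite_subset by blast
  have q: "\<bar>real (edge_degree G F v) - r * real (edge_degree G X v)\<bar> \<le> (if v \<in> W then 2 else 1)"
    if "v \<in> verts G" for v
    using F(2)[OF that] unfolding U_def by (auto split: if_splits)
  show ?thesis
  proof (rule that[OF F(1)])
    fix v assume v: "v \<in> verts G"
    let ?f = "real (edge_degree G F v)" and ?x = "real (edge_degree G X v)"
    have "\<bar>r * (?x - t v)\<bar> = r * \<bar>?x - t v\<bar>" "\<bar>(1 - r) * (?x - t v)\<bar> = (1 - r) * \<bar>?x - t v\<bar>"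
      using r by (simp_all add: abs_mult)
    moreover have "?f - r * t v = (?f - r * ?x) + r * (?x - t v)"
      "(?x - ?f) - (1 - r) * t v = (1 - r) * (?x - t v) - (?f - r * ?x)"
      by (simp_all add: algebra_simps)
    moreover have "real (edge_degree G (X - F) v) = ?x - ?f"
      using edge_degree_split[OF finX F(1), of G v] by simp
    ultimately show "\<bar>?f - r * t v\<bar> \<le> (if v \<in> W then 2 else 1) + r * \<bar>?x - t v\<bar>"
      "\<bar>real (edge_degree G (X - F) v) - (1 - r) * t v\<bar>
        \<le> (if v \<in> W then 2 else 1) + (1 - r) * \<bar>?x - t v\<bar>"
      using q[OF v] by linarith+
  next
    show "even (edge_degree G F v)" if "v \<in> W" "even (edge_degree G X v)" for v
      using F(3) that unfolding U_def by auto
  qed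
qed

lemma ex_heaviest:
  fixes s :: "'i \<Rightarrow> real"
  assumes "finite I" "I \<noteq> {}"
  obtains c where "c \<in> I" "\<And>i. i \<in> I \<Longrightarrow> s i \<le> s c"
proof -
  have "Max (s ` I) \<in> s ` I" using assms by (intro Max_in) auto
  then obtain c where "c \<in> I" "s c = Max (s ` I)" by auto
  then show ?thesis using that[of c] assms(1) by simp
qed

text \<open>Weights more than a factor of two apart grow faster than the powers of two.\<close>

lemma sum_others_le_max:
  fixes s :: "'i \<Rightarrow> real"
  assumes "finite I" "c \<in> I" "\<And>i. i \<in> I \<Longrightarrow> 0 \<le> s i" "\<And>i. i \<in> I \<Longrightarrow> s i \<le> s c"
    and "\<And>i j. i \<in> I \<Longrightarrow> j \<in> I \<Longrightarrow> i \<noteq> j \<Longrightarrow> s i \<le> s j \<Longrightarrow> 2 * s i < s j"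
  shows "sum s (I - {c}) \<le> s c"
  using assms
proof (induction I arbitrary: c rule: finite_psubset_induct)
  case (psubset I)
  show ?case
  proof (cases "I - {c} = {}")
    case True
    then show ?thesis unfolding True using psubset.prems(1,2) by simp
  next
    case False
    obtain c' where c': "c' \<in> I - {c}" "\<And>i. i \<in> I - {c} \<Longrightarrow> s i \<le> s c'"
      using ex_heaviest[of "I - {c}" s] False psubset.hyps by (metis finite_Diff)
    have "sum s (I - {c} - {c'}) \<le> s c'"
    proof (rule psubset.IH)
      show "I - {c} \<subset> I" using psubset.prems by blast
    qed (use c' psubset.prems in auto)
    moreover have "sum s (I - {c}) = s c' + sum s (I - {c} - {c'})"
      using c' psubset.hyps by (intro sum.remove) auto
    moreover have "2 * s c' < s c" using psubset.prems(4)[of c' c] psubset.prems(1,3) c' by auto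
    ultimately show ?thesis by linarith
  qed
qed

text \<open>Induction on the number of parts; \<open>q\<close> below is the error of a single splitting.  Two weights within a
factor of two of each other are first treated as one: the joint part has error below \<open>3 q\<close>, and
splitting it gives each side at most two thirds of that plus \<open>q\<close>, again below \<open>3 q\<close>.  If there are no such
weights, the heaviest is at least the sum of the others.  Its part is split off, with error below
\<open>2 q + q\<close>; the remainder has at most half of the weight, so its error stays below \<open>2 q / 2 + q = 2 q\<close>
and the induction goes on.  Starting from an error below \<open>2 q\<close>, rather than \<open>0\<close>, is what permits this
step, and also permits a first part to be removed beforehand.

A splitting preserves evenness of a degree and makes exactly one of the two parts of an odd degree odd, so
at most one part is odd at each vertex of \<open>W\<close>.\<close>

lemma parts_of_bounded_error:
  fixes s :: "'i \<Rightarrow> real" and D :: "'v \<Rightarrow> real"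
  assumes G: "finite_multigraph G" and W: "W \<subseteq> verts G"
    and "finite I" "I \<noteq> {}" "\<And>i. i \<in> I \<Longrightarrow> 0 \<le> s i" "X \<subseteq> edges G"
    and "\<And>v. v \<in> verts G \<Longrightarrow>
      \<bar>real (edge_degree G X v) - sum s I * D v\<bar> < 2 * (if v \<in> W then 2 else 1)"
  shows "\<exists>Y. disjoint_family_on Y I \<and> (\<Union>i\<in>I. Y i) = X \<and>
    (\<forall>v\<in>verts G. \<forall>i\<in>I. \<bar>real (edge_degree G (Y i) v) - s i * D v\<bar> < 3 * (if v \<in> W then 2 else 1)) \<and>
    (\<forall>v\<in>W. (even (edge_degree G X v) \<longrightarrow> (\<forall>i\<in>I. even (edge_degree G (Y i) v))) \<and>
      (\<exists>j\<in>I. \<forall>i\<in>I. i \<noteq> j \<longrightarrow> even (edge_degree G (Y i) v)))"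
  using assms(3-)
proof (induction I arbitrary: s X rule: finite_psubset_induct)
  case (psubset I)
  define q :: "'v \<Rightarrow> real" where "q v = (if v \<in> W then 2 else 1)" for v
  have q_pos: "0 < q v" for v unfolding q_def by auto
  note prem_nn = psubset.prems(2) and prem_X = psubset.prems(3)
    and prem_err = psubset.prems(4)[folded q_def]
  have finE: "finite Z" if "Z \<subseteq> edges G" for Z
    using that finite_multigraph.finite_edges[OF G] finite_subset by blast
  consider (single) c where "I = {c}"
    | (close) u u' where "u \<in> I" "u' \<in> I" "u \<noteq> u'" "s u \<le> s u'" "s u' \<le> 2 * s u"
    | (sparse) "\<nexists>c. I = {c}" "\<And>i j. i \<in> I \<Longrightarrow> j \<in> I \<Longrightarrow> i \<noteq> j \<Longrightarrow> s i \<le> s j \<Longrightarrow> 2 * s i < s j"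
    by (meson not_le)
  then show ?case
  proof cases
    case single
    have "\<bar>real (edge_degree G X v) - s c * D v\<bar> < 3 * q v" if "v \<in> verts G" for v
      using prem_err[OF that] single q_pos[of v] by simp
    then show ?thesis
      unfolding q_def[symmetric] using single
      by (intro exI[of _ "\<lambda>_. X"]) (auto simp: disjoint_family_on_def)
  next
    case close
    define s' where "s' = s(u := s u + s u')"
    have uI: "u \<in> I - {u'}" using close by auto
    have sum_eq: "sum s' (I - {u'}) = sum s I"
    proof -
      have "sum s' (I - {u'}) = s' u + sum s' (I - {u'} - {u})"
        using psubset.hyps uI by (intro sum.remove) auto
      also have "sum s' (I - {u'} - {u}) = sum s (I - {u'} - {u})"
        unfolding s'_def by (intro sum.cong) auto
      also have "s' u + sum s (I - {u'} - {u}) = s u' + (s u + sum s (I - {u'} - {u}))"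
        unfolding s'_def by simp
      also have "s u + sum s (I - {u'} - {u}) = sum s (I - {u'})"
        using psubset.hyps uI by (intro sum.remove[symmetric]) auto
      also have "s u' + sum s (I - {u'}) = sum s I"
        using psubset.hyps close by (intro sum.remove[symmetric]) auto
      finally show ?thesis .
    qed
    have "\<exists>Y. disjoint_family_on Y (I - {u'}) \<and> (\<Union>i\<in>I - {u'}. Y i) = X \<and>
      (\<forall>v\<in>verts G. \<forall>i\<in>I - {u'}. \<bar>real (edge_degree G (Y i) v) - s' i * D v\<bar> < 3 * (if v \<in> W then 2 else 1)) \<and>
      (\<forall>v\<in>W. (even (edge_degree G X v) \<longrightarrow> (\<forall>i\<in>I - {u'}. even (edge_degree G (Y i) v))) \<and>
        (\<exists>j\<in>I - {u'}. \<forall>i\<in>I - {u'}. i \<noteq> j \<longrightarrow> even (edge_degree G (Y i) v)))"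
    proof (rule psubset.IH)
      show "I - {u'} \<subset> I" "I - {u'} \<noteq> {}" using close by auto
      show "0 \<le> s' i" if "i \<in> I - {u'}" for i using that prem_nn close unfolding s'_def by auto
      show "X \<subseteq> edges G" by fact
    qed (use sum_eq psubset.prems(4) in auto)
    then obtain Y where Y: "disjoint_family_on Y (I - {u'})" "(\<Union>i\<in>I - {u'}. Y i) = X"
      "\<And>v i. v \<in> verts G \<Longrightarrow> i \<in> I - {u'} \<Longrightarrow> \<bar>real (edge_degree G (Y i) v) - s' i * D v\<bar> < 3 * q v"
      "\<And>v i. v \<in> W \<Longrightarrow> even (edge_degree G X v) \<Longrightarrow> i \<in> I - {u'} \<Longrightarrow> even (edge_degree G (Y i) v)"
      "\<And>v. v \<in> W \<Longrightarrow> \<exists>j\<in>I - {u'}. \<forall>i\<in>I - {u'}. i \<noteq> j \<longrightarrow> even (edge_degree G (Y i) v)"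
      unfolding q_def by metis
    (* If both weights vanish, any share will do; one half respects the bounds. *)
    obtain r where r: "r * (s u + s u') = s u" "0 \<le> r" "r \<le> 2 / 3" "1 - r \<le> 2 / 3"
    proof (cases "s u + s u' = 0")
      case True
      then have "s u = 0" using prem_nn close by (smt (verit))
      then show ?thesis using True that[of "1 / 2"] by simp
    next
      case False
      then have "0 < s u + s u'" using prem_nn close by (smt (verit))
      then show ?thesis using close prem_nn[of u]
        by (intro that[of "s u / (s u + s u')"]) (auto simp: field_simps)
    qed
    have r': "(1 - r) * (s u + s u') = s u'" using r(1) by (simp add: algebra_simps)
    have Yu: "Y u \<subseteq> X" "Y u \<subseteq> edges G" using Y(2) uI prem_X by auto
    obtain F where F: "F \<subseteq> Y u"
      "\<And>v. v \<in> verts G \<Longrightarrow> \<bar>real (edge_degree G F v) - r * ((s u + s u') * D v)\<bar>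
           \<le> q v + r * \<bar>real (edge_degree G (Y u) v) - (s u + s u') * D v\<bar>"
      "\<And>v. v \<in> verts G \<Longrightarrow> \<bar>real (edge_degree G (Y u - F) v) - (1 - r) * ((s u + s u') * D v)\<bar>
           \<le> q v + (1 - r) * \<bar>real (edge_degree G (Y u) v) - (s u + s u') * D v\<bar>"
      "\<And>v. v \<in> W \<Longrightarrow> even (edge_degree G (Y u) v) \<Longrightarrow> even (edge_degree G F v)"
      using scaled_splitting[OF G Yu(2) W r(2), of "\<lambda>v. (s u + s u') * D v"] r(3)
      unfolding q_def by (smt (verit) divide_less_eq_1)
    define Z where "Z = Y(u := F, u' := Y u - F)"
    have Z: "Z u = F" "Z u' = Y u - F" "\<And>i. i \<noteq> u \<Longrightarrow> i \<noteq> u' \<Longrightarrow> Z i = Y i"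
      using close(3) unfolding Z_def by auto
    have deg_sum: "edge_degree G (Y u) v = edge_degree G F v + edge_degree G (Y u - F) v" for v
      by (rule edge_degree_split[OF finE[OF Yu(2)] F(1)])
    have "disjoint_family_on Z I"
      unfolding disjoint_family_on_def
    proof (intro ballI impI)
      fix i j assume ij: "i \<in> I" "j \<in> I" "i \<noteq> j"
      have dis: "Y k \<inter> Y l = {}" if "k \<in> I - {u'}" "l \<in> I - {u'}" "k \<noteq> l" for k l
        using Y(1) that unfolding disjoint_family_on_def by blast
      define p where "p k = (if k = u' then u else k)" for k
      have sub: "Z k \<subseteq> Y (p k)" for k using F(1) unfolding Z_def p_def by auto
      show "Z i \<inter> Z j = {}"
      proof (cases "p i = p j")
        case True
        then have "{i, j} = {u, u'}" using ij unfolding p_def by (auto split: if_splits)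
        then show ?thesis using Z ij by (auto simp: doubleton_eq_iff)
      next
        case False
        then show ?thesis using dis[of "p i" "p j"] sub[of i] sub[of j] ij uI unfolding p_def
          by (auto split: if_splits)
      qed
    qed
    moreover have "(\<Union>i\<in>I. Z i) = X"
    proof -
      have "(\<Union>i\<in>I. Z i) = Z u \<union> Z u' \<union> (\<Union>i\<in>I - {u, u'}. Z i)" using close by auto
      also have "\<dots> = Y u \<union> (\<Union>i\<in>I - {u, u'}. Y i)" using Z F(1) by auto
      also have "\<dots> = (\<Union>i\<in>I - {u'}. Y i)" using uI by auto
      finally show ?thesis using Y(2) by simp
    qed
    moreover have "\<bar>real (edge_degree G (Z i) v) - s i * D v\<bar> < 3 * q v" if v: "v \<in> verts G" "i \<in> I" for i v
    proof -
      have err: "\<bar>real (edge_degree G (Y u) v) - (s u + s u') * D v\<bar> < 3 * q v"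
        using Y(3)[OF v(1) uI] unfolding s'_def by simp
      have small: "q v + \<rho> * E < 3 * q v" if "\<rho> \<le> 2 / 3" "E < 3 * q v" "0 \<le> E" for \<rho> E
        using mult_right_mono[OF that(1,3)] that(2) by linarith
      note small = small[OF _ err abs_ge_zero]
      have "\<bar>real (edge_degree G F v) - s u * D v\<bar> < 3 * q v"
        using F(2)[OF v(1)] small[OF r(3)] r(1) by (simp flip: mult.assoc)
      moreover have "\<bar>real (edge_degree G (Y u - F) v) - s u' * D v\<bar> < 3 * q v"
        using F(3)[OF v(1)] small[OF r(4)] r' by (simp flip: mult.assoc)
      moreover have "\<bar>real (edge_degree G (Y i) v) - s i * D v\<bar> < 3 * q v" if "i \<noteq> u" "i \<noteq> u'"
        using Y(3)[OF v(1), of i] that v(2) unfolding s'_def by simp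
      ultimately show ?thesis using Z by (cases "i = u"; cases "i = u'") auto
    qed
    moreover have "even (edge_degree G (Z i) v)" if v: "v \<in> W" "even (edge_degree G X v)" "i \<in> I" for i v
    proof -
      have "even (edge_degree G (Y u) v)" using Y(4) v uI by blast
      then have "even (edge_degree G F v)" "even (edge_degree G (Y u - F) v)"
        using F(4)[OF v(1)] deg_sum[of v] by auto
      moreover have "even (edge_degree G (Y i) v)" if "i \<noteq> u'" using Y(4) v that by blast
      ultimately show ?thesis using Z by (cases "i = u"; cases "i = u'") auto
    qed
    moreover have "\<exists>j\<in>I. \<forall>i\<in>I. i \<noteq> j \<longrightarrow> even (edge_degree G (Z i) v)" if v: "v \<in> W" for v
    proof -
      obtain j where j: "j \<in> I - {u'}" "\<And>i. i \<in> I - {u'} \<Longrightarrow> i \<noteq> j \<Longrightarrow> even (edge_degree G (Y i) v)"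
        using Y(5)[OF v] by blast
      show ?thesis
      proof (cases "even (edge_degree G (Y u) v)")
        case True
        then have "even (edge_degree G F v)" "even (edge_degree G (Y u - F) v)"
          using F(4)[OF v(1)] deg_sum[of v] by auto
        then have "even (edge_degree G (Z i) v)" if "i \<in> I" "i \<noteq> j" for i
          using Z j(2)[of i] that by (cases "i = u"; cases "i = u'") auto
        then show ?thesis using j(1) by blast
      next
        case False
        then have ju: "j = u" using j(2)[OF uI] by metis
        define j' where "j' = (if even (edge_degree G F v) then u' else u)"
        have one: "even (edge_degree G F v) \<noteq> even (edge_degree G (Y u - F) v)"
          using False unfolding deg_sum by simp
        have "even (edge_degree G (Z i) v)" if i: "i \<in> I" "i \<noteq> j'" for i
        proof -
          consider "i = u" | "i = u'" | "i \<noteq> u" "i \<noteq> u'" by blast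
          then show ?thesis
          proof cases
            case 1
            then show ?thesis using i(2) Z(1) unfolding j'_def by (metis (full_types))
          next
            case 2
            then show ?thesis using i(2) Z(2) one unfolding j'_def by (metis (full_types))
          next
            case 3
            then show ?thesis using j(2)[of i] i(1) Z(3)[of i] ju by simp
          qed
        qed
        then show ?thesis using close(1,2) unfolding j'_def by (metis (full_types))
      qed
    qed
    ultimately show ?thesis unfolding q_def by blast
  next
    case sparse
    obtain c where c: "c \<in> I" "\<And>i. i \<in> I \<Longrightarrow> s i \<le> s c"
      using ex_heaviest[of I s] psubset.prems(1) psubset.hyps by metis
    define w where "w = sum s (I - {c})"
    have w: "0 \<le> w" "w \<le> s c"
      using sum_others_le_max[where s = s, OF psubset.hyps c(1) prem_nn c(2) sparse(2)] prem_nn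
      unfolding w_def by (auto intro: sum_nonneg)
    have total: "sum s I = s c + w" unfolding w_def using psubset.hyps c(1) by (intro sum.remove)
    obtain r where r: "r * (s c + w) = s c" "0 \<le> r" "r \<le> 1" "1 - r \<le> 1 / 2"
    proof (cases "s c + w = 0")
      case True
      then have "s c = 0" using w by linarith
      then show ?thesis using True that[of "1 / 2"] by simp
    next
      case False
      then have "0 < s c + w" using w by linarith
      then show ?thesis using w by (intro that[of "s c / (s c + w)"]) (auto simp: field_simps)
    qed
    have r': "(1 - r) * (s c + w) = w" using r(1) by (simp add: algebra_simps)
    obtain F where F: "F \<subseteq> X"
      "\<And>v. v \<in> verts G \<Longrightarrow> \<bar>real (edge_degree G F v) - r * ((s c + w) * D v)\<bar>
           \<le> q v + r * \<bar>real (edge_degree G X v) - (s c + w) * D v\<bar>"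
      "\<And>v. v \<in> verts G \<Longrightarrow> \<bar>real (edge_degree G (X - F) v) - (1 - r) * ((s c + w) * D v)\<bar>
           \<le> q v + (1 - r) * \<bar>real (edge_degree G X v) - (s c + w) * D v\<bar>"
      "\<And>v. v \<in> W \<Longrightarrow> even (edge_degree G X v) \<Longrightarrow> even (edge_degree G F v)"
      using scaled_splitting[OF G prem_X W r(2,3), of "\<lambda>v. (s c + w) * D v"] unfolding q_def by metis
    have err: "\<bar>real (edge_degree G X v) - (s c + w) * D v\<bar> < 2 * q v" if "v \<in> verts G" for v
      using prem_err[OF that] total by simp
    have F_err: "\<bar>real (edge_degree G F v) - s c * D v\<bar> < 3 * q v" if v: "v \<in> verts G" for v
    proof -
      have "r * \<bar>real (edge_degree G X v) - (s c + w) * D v\<bar> \<le> \<bar>real (edge_degree G X v) - (s c + w) * D v\<bar>"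
        using r by (simp add: mult_left_le_one_le)
      moreover have "r * ((s c + w) * D v) = s c * D v" using r(1) by (simp flip: mult.assoc)
      ultimately show ?thesis using F(2)[OF v] err[OF v] by linarith
    qed
    have rest_err: "\<bar>real (edge_degree G (X - F) v) - w * D v\<bar> < 2 * q v" if v: "v \<in> verts G" for v
    proof -
      have half: "x < 2 * q v" if "x \<le> q v + (1 - r) * E" "E < 2 * q v" "0 \<le> E" for x E
        using mult_right_mono[OF r(4) that(3)] that(1,2) by linarith
      have "(1 - r) * ((s c + w) * D v) = w * D v" using r' by (simp flip: mult.assoc)
      then show ?thesis using half[OF F(3)[OF v] err[OF v] abs_ge_zero] by (simp only:)
    qed
    have "\<exists>Y. disjoint_family_on Y (I - {c}) \<and> (\<Union>i\<in>I - {c}. Y i) = X - F \<and>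
      (\<forall>v\<in>verts G. \<forall>i\<in>I - {c}. \<bar>real (edge_degree G (Y i) v) - s i * D v\<bar> < 3 * (if v \<in> W then 2 else 1)) \<and>
      (\<forall>v\<in>W. (even (edge_degree G (X - F) v) \<longrightarrow> (\<forall>i\<in>I - {c}. even (edge_degree G (Y i) v))) \<and>
        (\<exists>j\<in>I - {c}. \<forall>i\<in>I - {c}. i \<noteq> j \<longrightarrow> even (edge_degree G (Y i) v)))"
    proof (rule psubset.IH)
      show "I - {c} \<subset> I" "I - {c} \<noteq> {}" using c sparse(1) by auto
      show "X - F \<subseteq> edges G" using prem_X by auto
      show "\<bar>real (edge_degree G (X - F) v) - sum s (I - {c}) * D v\<bar> < 2 * (if v \<in> W then 2 else 1)"
        if "v \<in> verts G" for v using rest_err[OF that] unfolding w_def q_def .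
    qed (use prem_nn in auto)
    then obtain Y where Y: "disjoint_family_on Y (I - {c})" "(\<Union>i\<in>I - {c}. Y i) = X - F"
      "\<And>v i. v \<in> verts G \<Longrightarrow> i \<in> I - {c} \<Longrightarrow> \<bar>real (edge_degree G (Y i) v) - s i * D v\<bar> < 3 * q v"
      "\<And>v i. v \<in> W \<Longrightarrow> even (edge_degree G (X - F) v) \<Longrightarrow> i \<in> I - {c} \<Longrightarrow> even (edge_degree G (Y i) v)"
      "\<And>v. v \<in> W \<Longrightarrow> \<exists>j\<in>I - {c}. \<forall>i\<in>I - {c}. i \<noteq> j \<longrightarrow> even (edge_degree G (Y i) v)"
      unfolding q_def by metis
    define Z where "Z = Y(c := F)"
    have Z: "Z c = F" "\<And>i. i \<noteq> c \<Longrightarrow> Z i = Y i" unfolding Z_def by auto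
    have deg_sum: "edge_degree G X v = edge_degree G F v + edge_degree G (X - F) v" for v
      by (rule edge_degree_split[OF finE[OF prem_X] F(1)])
    have "disjoint_family_on Z I"
      unfolding disjoint_family_on_def
    proof (intro ballI impI)
      fix i j assume ij: "i \<in> I" "j \<in> I" "i \<noteq> j"
      have "Y k \<inter> F = {}" if "k \<in> I - {c}" for k using Y(2) that by blast
      then show "Z i \<inter> Z j = {}"
        using ij Y(1) Z unfolding disjoint_family_on_def
        by (cases "i = c"; cases "j = c") (auto simp: Int_commute)
    qed
    moreover have "(\<Union>i\<in>I. Z i) = X"
    proof -
      have "(\<Union>i\<in>I. Z i) = Z c \<union> (\<Union>i\<in>I - {c}. Z i)" using c by auto
      also have "\<dots> = F \<union> (\<Union>i\<in>I - {c}. Y i)" using Z by auto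
      finally show ?thesis using Y(2) F(1) by auto
    qed
    moreover have "\<bar>real (edge_degree G (Z i) v) - s i * D v\<bar> < 3 * q v" if v: "v \<in> verts G" "i \<in> I" for i v
      using F_err[OF v(1)] Y(3)[OF v(1), of i] v(2) Z by (cases "i = c") auto
    moreover have "even (edge_degree G (Z i) v)" if v: "v \<in> W" "even (edge_degree G X v)" "i \<in> I" for i v
      using F(4)[OF v(1,2)] Y(4)[OF v(1), of i] deg_sum[of v] v Z by (cases "i = c") auto
    moreover have "\<exists>j\<in>I. \<forall>i\<in>I. i \<noteq> j \<longrightarrow> even (edge_degree G (Z i) v)" if v: "v \<in> W" for v
    proof (cases "even (edge_degree G F v)")
      case True
      obtain j where j: "j \<in> I - {c}" "\<And>i. i \<in> I - {c} \<Longrightarrow> i \<noteq> j \<Longrightarrow> even (edge_degree G (Y i) v)"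
        using Y(5)[OF v] by blast
      then have "even (edge_degree G (Z i) v)" if "i \<in> I" "i \<noteq> j" for i
        using Z that True by (cases "i = c") auto
      then show ?thesis using j(1) by blast
    next
      case False
      then have "even (edge_degree G (X - F) v)" using F(4)[OF v] deg_sum[of v] by auto
      then have "even (edge_degree G (Z i) v)" if "i \<in> I" "i \<noteq> c" for i
        using Y(4)[OF v] Z that by auto
      then show ?thesis using c(1) by blast
    qed
    ultimately show ?thesis unfolding q_def by blast
  qed
qed

section \<open>Equitable factorizations with one odd factor\<close>

theorem corollary8p2:
  fixes G :: "('v, 'e) multigraph" and V :: "nat \<Rightarrow> 'v set"
    and k :: nat and \<epsilon> :: "nat \<Rightarrow> real"
  assumes "\<And>i. i \<in> {1..k} \<Longrightarrow> 0 \<le> \<epsilon> i"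
    and "(\<Sum>i = 1..k. \<epsilon> i) = 1"
    and "finite_multigraph G"
    and "V 1 \<union> V 2 = verts G" and "V 1 \<inter> V 2 = {}"
  shows
    "(\<exists>H :: nat \<Rightarrow> ('v, 'e) multigraph. factor_decomposition G k H \<and>
        (\<forall>q \<in> {1, 2}. \<forall>v \<in> V q. \<forall>i \<in> {1..k}.
           \<bar>real (degree (H i) v) - \<epsilon> i * real (degree G v)\<bar> < 3 * real q) \<and>
        (\<forall>v \<in> V 2. \<exists>\<^sub>\<le>\<^sub>1 j. j \<in> {1..k} \<and> odd (degree (H j) v))) \<and>
     (\<epsilon> 1 > 0 \<and> odd_edge_connected (nat \<lceil>1 / \<epsilon> 1\<rceil>) G \<longrightarrow>
      (\<exists>H :: nat \<Rightarrow> ('v, 'e) multigraph. factor_decomposition G k H \<and>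
        (\<forall>q \<in> {1, 2}. \<forall>v \<in> V q. \<forall>i \<in> {1..k}.
           \<bar>real (degree (H i) v) - \<epsilon> i * real (degree G v)\<bar> < 3 * real q) \<and>
        (\<forall>v \<in> V 2. \<exists>\<^sub>\<le>\<^sub>1 j. j \<in> {1..k} \<and> odd (degree (H j) v)) \<and>
        (\<forall>v \<in> V 2. odd (degree G v) \<longrightarrow>
           (\<forall>j \<in> {1..k}. odd (degree (H j) v) \<longleftrightarrow> j = 1))))"
proof (intro conjI impI)
  define tol :: "'v \<Rightarrow> real" where "tol v = (if v \<in> V 2 then 2 else 1)" for v
  have tol: "v \<in> verts G \<and> tol v = real q" if "q \<in> {1, 2}" "v \<in> V q" for q v
    using that assms(4,5) unfolding tol_def by auto
  have W: "V 2 \<subseteq> verts G" using assms(4) by auto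
  have k: "1 \<le> k" using assms(2) by (cases k) auto
  have decomposition: "factor_decomposition G k (\<lambda>i. G\<lparr>edges := Y i\<rparr>)"
    if "disjoint_family_on Y {1..k}" "(\<Union>i\<in>{1..k}. Y i) = edges G" for Y
    using that unfolding factor_decomposition_def is_factor_def by auto
  (* All edges form a group of total weight 1 and error 0. *)
  {
    obtain Y where Y: "disjoint_family_on Y {1..k}" "(\<Union>i\<in>{1..k}. Y i) = edges G"
      "\<And>v i. v \<in> verts G \<Longrightarrow> i \<in> {1..k} \<Longrightarrow>
        \<bar>real (edge_degree G (Y i) v) - \<epsilon> i * real (degree G v)\<bar> < 3 * tol v"
      "\<And>v. v \<in> V 2 \<Longrightarrow> \<exists>j\<in>{1..k}. \<forall>i\<in>{1..k}. i \<noteq> j \<longrightarrow> even (edge_degree G (Y i) v)"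
      using parts_of_bounded_error[OF assms(3) W, of "{1..k}" \<epsilon> "edges G" "\<lambda>v. real (degree G v)"]
        assms(1,2) k unfolding tol_def by auto
    show "\<exists>H. factor_decomposition G k H \<and>
        (\<forall>q \<in> {1, 2}. \<forall>v \<in> V q. \<forall>i \<in> {1..k}.
           \<bar>real (degree (H i) v) - \<epsilon> i * real (degree G v)\<bar> < 3 * real q) \<and>
        (\<forall>v \<in> V 2. \<exists>\<^sub>\<le>\<^sub>1 j. j \<in> {1..k} \<and> odd (degree (H j) v))"
    proof (intro exI conjI ballI)
      show "factor_decomposition G k (\<lambda>i. G\<lparr>edges := Y i\<rparr>)" using decomposition Y(1,2) .
      show "\<bar>real (edge_degree G (Y i) v) - \<epsilon> i * real (degree G v)\<bar> < 3 * real q"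
        if "q \<in> {1, 2}" "v \<in> V q" "i \<in> {1..k}" for q v i
        using Y(3)[of v i] tol[OF that(1,2)] that(3) by simp
      show "\<exists>\<^sub>\<le>\<^sub>1 j. j \<in> {1..k} \<and> odd (edge_degree G (Y j) v)" if "v \<in> V 2" for v
        using Y(4)[OF that] by (intro Uniq_I) metis
    qed
  }
  assume conn: "0 < \<epsilon> 1 \<and> odd_edge_connected (nat \<lceil>1 / \<epsilon> 1\<rceil>) G"
  have \<epsilon>1: "\<epsilon> 1 \<le> 1"
    using member_le_sum[of 1 "{1..k}" \<epsilon>] assms(1,2) k by auto
  have cut: "1 \<le> \<epsilon> 1 * real (card (cut_edges G A))"
    if "A \<subseteq> V 2" "odd (card (cut_edges G A))" for A
  proof -
    have "nat \<lceil>1 / \<epsilon> 1\<rceil> \<le> card (cut_edges G A)"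
      using conn that W unfolding odd_edge_connected_def by blast
    then have "1 / \<epsilon> 1 \<le> real (card (cut_edges G A))" by linarith
    then show ?thesis using conn by (simp add: field_simps)
  qed
  (* The first factor takes the parity of G at every vertex of V 2; the rest of G, which is
     even there, has the same error as F and can be divided among the other indices. *)
  obtain F where F: "F \<subseteq> edges G"
    "\<And>v. v \<in> verts G \<Longrightarrow> \<bar>real (edge_degree G F v) - \<epsilon> 1 * real (degree G v)\<bar> \<le> tol v"
    "\<And>v. v \<in> V 2 \<Longrightarrow> even (edge_degree G F v) \<longleftrightarrow> even (degree G v)"
  proof -
    have "\<exists>F \<subseteq> edges G. \<forall>v \<in> verts G.
        \<bar>real (edge_degree G F v) - \<epsilon> 1 * real (degree G v)\<bar> \<le> (if v \<in> V 2 then 2 else 1) \<and>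
        (v \<in> V 2 \<longrightarrow> (even (edge_degree G F v) \<longleftrightarrow> even (degree G v)))"
      using conn \<epsilon>1 cut by (intro parity_respecting_splitting[OF assms(3) W]) auto
    then show ?thesis using that W unfolding tol_def by blast
  qed
  have deg_sum: "degree G v = edge_degree G F v + edge_degree G (edges G - F) v" for v
    using edge_degree_split[OF finite_multigraph.finite_edges[OF assms(3)] F(1), of G v] by simp
  have tol_pos: "0 < tol v" for v unfolding tol_def by auto
  obtain Y where Y: "disjoint_family_on Y {1..k}" "(\<Union>i\<in>{1..k}. Y i) = edges G"
    "\<And>v i. v \<in> verts G \<Longrightarrow> i \<in> {1..k} \<Longrightarrow>
        \<bar>real (edge_degree G (Y i) v) - \<epsilon> i * real (degree G v)\<bar> < 3 * tol v"
    "\<And>v i. v \<in> V 2 \<Longrightarrow> i \<in> {1..k} \<Longrightarrow> odd (edge_degree G (Y i) v) \<longleftrightarrow> i = 1 \<and> odd (degree G v)"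
  proof (cases "k = 1")
    case True
    then have "\<epsilon> 1 = 1" using assms(2) by simp
    then show ?thesis using True tol_pos
      by (intro that[of "\<lambda>_. edges G"]) (auto simp: disjoint_family_on_def)
  next
    case False
    have sum2: "sum \<epsilon> {2..k} = 1 - \<epsilon> 1"
    proof -
      have "sum \<epsilon> {1..k} = \<epsilon> 1 + sum \<epsilon> {Suc 1..k}" using k by (rule sum.atLeast_Suc_atMost)
      then show ?thesis using assms(2) by (simp add: numeral_2_eq_2)
    qed
    have "\<bar>real (edge_degree G (edges G - F) v) - sum \<epsilon> {2..k} * real (degree G v)\<bar>
        < 2 * (if v \<in> V 2 then 2 else 1)" if "v \<in> verts G" for v
    proof -
      have "real (edge_degree G (edges G - F) v) - sum \<epsilon> {2..k} * real (degree G v)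
          = - (real (edge_degree G F v) - \<epsilon> 1 * real (degree G v))"
        unfolding sum2 using deg_sum[of v] by (simp add: algebra_simps)
      then show ?thesis using F(2)[OF that] tol_pos[of v] unfolding tol_def by (auto split: if_splits)
    qed
    then obtain Y where Y: "disjoint_family_on Y {2..k}" "(\<Union>i\<in>{2..k}. Y i) = edges G - F"
      "\<And>v i. v \<in> verts G \<Longrightarrow> i \<in> {2..k} \<Longrightarrow>
        \<bar>real (edge_degree G (Y i) v) - \<epsilon> i * real (degree G v)\<bar> < 3 * tol v"
      "\<And>v i. v \<in> V 2 \<Longrightarrow> even (edge_degree G (edges G - F) v) \<Longrightarrow> i \<in> {2..k} \<Longrightarrow> even (edge_degree G (Y i) v)"
      using parts_of_bounded_error[OF assms(3) W, of "{2..k}" \<epsilon> "edges G - F" "\<lambda>v. real (degree G v)"]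
        assms(1) k False unfolding tol_def by auto
    define Z where "Z = Y(1 := F)"
    have Z: "Z 1 = F" "\<And>i. i \<in> {2..k} \<Longrightarrow> Z i = Y i" unfolding Z_def by auto
    have I: "{1..k} = insert 1 {2..k}" using k by auto
    show ?thesis
    proof (rule that[of Z])
      have "(\<Union>i\<in>{2..k}. Z i) = edges G - F" using Y(2) Z(2) by simp
      then show "(\<Union>i\<in>{1..k}. Z i) = edges G" unfolding I using F(1) Z(1) by auto
      have "disjoint_family_on Z {2..k}" using Y(1) Z(2) unfolding disjoint_family_on_def by simp
      then show "disjoint_family_on Z {1..k}"
        unfolding I using \<open>(\<Union>i\<in>{2..k}. Z i) = edges G - F\<close> Z(1)
        by (subst disjoint_family_on_insert) auto
      show "\<bar>real (edge_degree G (Z i) v) - \<epsilon> i * real (degree G v)\<bar> < 3 * tol v"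
        if "v \<in> verts G" "i \<in> {1..k}" for v i
        using that F(2)[OF that(1)] Y(3)[OF that(1), of i] Z tol_pos[of v] unfolding I by auto
      show "odd (edge_degree G (Z i) v) \<longleftrightarrow> i = 1 \<and> odd (degree G v)"
        if "v \<in> V 2" "i \<in> {1..k}" for v i
      proof -
        have "even (edge_degree G (edges G - F) v)" using F(3)[OF that(1)] deg_sum[of v] by auto
        then show ?thesis using F(3)[OF that(1)] Y(4)[OF that(1)] Z that(2) unfolding I by auto
      qed
    qed
  qed
  show "\<exists>H. factor_decomposition G k H \<and>
        (\<forall>q \<in> {1, 2}. \<forall>v \<in> V q. \<forall>i \<in> {1..k}.
           \<bar>real (degree (H i) v) - \<epsilon> i * real (degree G v)\<bar> < 3 * real q) \<and>
        (\<forall>v \<in> V 2. \<exists>\<^sub>\<le>\<^sub>1 j. j \<in> {1..k} \<and> odd (degree (H j) v)) \<and>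
        (\<forall>v \<in> V 2. odd (degree G v) \<longrightarrow>
           (\<forall>j \<in> {1..k}. odd (degree (H j) v) \<longleftrightarrow> j = 1))"
  proof (intro exI conjI ballI impI)
    show "factor_decomposition G k (\<lambda>i. G\<lparr>edges := Y i\<rparr>)" using decomposition Y(1,2) .
    show "\<bar>real (edge_degree G (Y i) v) - \<epsilon> i * real (degree G v)\<bar> < 3 * real q"
      if "q \<in> {1, 2}" "v \<in> V q" "i \<in> {1..k}" for q v i
      using Y(3)[of v i] tol[OF that(1,2)] that(3) by simp
    show "\<exists>\<^sub>\<le>\<^sub>1 j. j \<in> {1..k} \<and> odd (edge_degree G (Y j) v)" if "v \<in> V 2" for v
      using Y(4)[OF that] by (intro Uniq_I) metis
    show "odd (edge_degree G (Y j) v) \<longleftrightarrow> j = 1"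
      if "v \<in> V 2" "odd (degree G v)" "j \<in> {1..k}" for v j
      using Y(4) that by blast
  qed
qed

end
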